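(* Let $p$ be a prime with $p>3$. Then $$\sum_{k=0}^{p-1}\frac{W_k}{(-3)^k}\equiv\sum_{k=0}^{p-1}\frac{W_k}{(-9)^k}\equiv \begin{cases} -L \pmod p&\text{if } p\equiv 1\pmod 3 \text{ and so } 4p=L^2+27M^2 \text{ with } L,M\in\mathbb Z,\ L\equiv 1\pmod 3,\\ 0\pmod p&\text{if } p\equiv 2\pmod 3\end{cases}$$ and $$\sum_{k=0}^{p-1}\binom{2k}k\frac{W_k}{(-12)^k}\equiv \begin{cases} L^2\pmod p&\text{if } p\equiv 1\pmod 3 \text{ and so } 4p=L^2+27M^2 \text{ with } L,M\in\mathbb Z,\\ 0\pmod p&\text{if } p\equiv 2\pmod 3.\end{cases}$$
   Context: For each nonnegative integer $n$, $W_n=\sum_{k=0}^{[n/3]}\binom{2k}k\binom{3k}k\binom n{3k}(-3)^{n-3k}$, where $[x]$ is the greatest integer not exceeding $x$. Congruences modulo $p$ between rational numbers are taken in the ring of rational numbers whose denominator is not divisible by $p$. *)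

theory Defs
  imports "HOL-Number_Theory.Number_Theory"
begin

definition W :: "nat \<Rightarrow> int" where
  "W n = (\<Sum>k=0..n div 3. int ((2 * k) choose k) * int ((3 * k) choose k) *
            int (n choose (3 * k)) * (-3) ^ (n - 3 * k))"

text \<open>
  The ring of rationals whose denominator in lowest terms is not divisible by \<open>p\<close>.
\<close>
definition p_integers :: "nat \<Rightarrow> rat set" where
  "p_integers p = {x. \<not> int p dvd snd (quotient_of x)}"

text \<open>
  Congruence modulo the ideal generated by \<open>p\<close> in that ring; both sides are required to
  belong to the ring. (The library's \<^const>\<open>cong\<close> taken on \<^typ>\<open>rat\<close> would be congruence in a field,
  hence trivial.)
\<close>
definition rat_cong :: "nat \<Rightarrow> rat \<Rightarrow> rat \<Rightarrow> bool" where
  "rat_cong p a b \<longleftrightarrow>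
     a \<in> p_integers p \<and> b \<in> p_integers p \<and> (\<exists>c \<in> p_integers p. a - b = of_nat p * c)"

end

(*
  Write a_k = (3k)!/k!^3. Modulo p, interchanging summations turns the two sums over W_k alone into
  sums over k of a_k times a closed form: the first collapses to a_n with p = 3n + 1 (and to 0 if
  there is no such n), the second is the sum of a_k r^(3k) with -6r = 1. Up to sign, the latter is
  the coefficient of (xyz)^(p-1) in (x^3 + y^3 + z^3 + 6xyz)^(p-1), that is, the power sum of this
  form over F_p^3. With s = x + y + z, a = x - z, b = y - z,
      3 (x^3 + y^3 + z^3 + 6xyz) = s^3 + (2a^3 - 3a^2 b - 3ab^2 + 2b^3),
  and the binary form is (a + wb)^3 + (a + w^2 b)^3 for a cube root of unity w. Hence for p = 1 mod 3
  the power sum equals that of the Fermat cubic, whose coefficient is a_n, and for p = 2 mod 3 it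
  vanishes because cubing is a bijection. The third sum collapses, by C(2k,k) = (-4)^k C((p-1)/2,k),
  to a_k 3^(-3k) with p = 6k + 1, which is C(4k,2k)^2 by Wilson's theorem and the duplication
  formula. Finally a_n = C(2n,n) = -L by the theory of the cubic Jacobi sum J = a + b omega,
  with L = 2a - b.
*)
theory Submission
  imports Defs
begin

subsection \<open>Congruences between \<open>p\<close>-integral rationals\<close>

text \<open>The coefficient of (xyz)^(p-1) is not visibly invariant under linear substitutions; the
  sum over F_p^3 is, because each substitution becomes a succession of reindexings of one summation
  variable. This is what allows two cubics to be compared. The constant 6 comes from r = -1/6, which
  the weight (-9)^(-n) produces. It is a special value: the cubic x^3 + y^3 + z^3 + c xyz has
  j-invariant 0 exactly for c = 0 and c^3 = 216, so c = 6 is a twin of the Fermat cubic c = 0. Their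
  equivalence is defined over F_p only when F_p contains \<open>w\<close>, hence the split by p
  modulo 3. The congruence C(2n,n) = -L leaves the sign of L to be settled: the Jacobi sum satisfies
  a = -1 and b = 0 modulo 3, which yields both the normalisation of L and the integrality of M =
  b/3. As the theorem speaks of every representation 4p = L^2 + 27 M^2, uniqueness of L^2 has to be
  shown as well.\<close>

lemma p_integers_iff:
  assumes "prime p"
  shows "x \<in> p_integers p \<longleftrightarrow> (\<exists>a b. \<not> int p dvd b \<and> x = of_int a / of_int b)"
proof
  assume "x \<in> p_integers p"
  then show "\<exists>a b. \<not> int p dvd b \<and> x = of_int a / of_int b"
    by (metis (mono_tags, lifting) mem_Collect_eq p_integers_def prod.collapse quotient_of_div)
next
  assume "\<exists>a b. \<not> int p dvd b \<and> x = of_int a / of_int b"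
  then obtain a b where b: "\<not> int p dvd b" and x: "x = of_int a / of_int b"
    by blast
  obtain c d where cd: "quotient_of x = (c, d)"
    by fastforce
  have d: "d > 0" and coprime: "coprime c d" and x': "x = of_int c / of_int d"
    using cd quotient_of_denom_pos quotient_of_coprime quotient_of_div by blast+
  have "b \<noteq> 0"
    using b by auto
  then have "of_int (a * d) = (of_int (c * b) :: rat)"
    using x x' d by (simp add: field_simps)
  then have eq: "a * d = c * b"
    using of_int_eq_iff by blast
  have "\<not> int p dvd d"
  proof
    assume "int p dvd d"
    then have "int p dvd c * b"
      using eq by (metis dvd_mult)
    then have "int p dvd c"
      using b assms by (simp add: prime_dvd_mult_iff)
    with \<open>int p dvd d\<close> coprime have "is_unit (int p)"
      by (meson coprime_common_divisor)
    then show False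
      using assms by auto
  qed
  then show "x \<in> p_integers p"
    using cd by (simp add: p_integers_def)
qed

lemma p_integers_of_int [simp]:
  assumes "prime p"
  shows "of_int a \<in> p_integers p"
  unfolding p_integers_iff[OF assms]
  using assms by (intro exI[of _ a] exI[of _ 1]) auto

lemma p_integers_add:
  assumes "prime p" "x \<in> p_integers p" "y \<in> p_integers p"
  shows "x + y \<in> p_integers p"
proof -
  obtain a b c d where "\<not> int p dvd b" "x = of_int a / of_int b"
    and "\<not> int p dvd d" "y = of_int c / of_int d"
    using assms unfolding p_integers_iff[OF assms(1)] by blast
  moreover from this have "b \<noteq> 0" "d \<noteq> 0"
    by auto
  ultimately have "x + y = of_int (a * d + c * b) / of_int (b * d)" "\<not> int p dvd b * d"
    using assms(1) by (simp_all add: field_simps prime_dvd_mult_iff)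
  then show ?thesis
    unfolding p_integers_iff[OF assms(1)] by blast
qed

lemma p_integers_uminus:
  assumes "prime p" "x \<in> p_integers p"
  shows "- x \<in> p_integers p"
  using assms(2) unfolding p_integers_iff[OF assms(1)]
  by (metis minus_divide_left of_int_minus)

lemma rat_cong_sym:
  assumes "prime p" "rat_cong p x y"
  shows "rat_cong p y x"
proof -
  obtain c where "c \<in> p_integers p" "x - y = of_nat p * c"
    using assms(2) by (auto simp: rat_cong_def)
  then have "- c \<in> p_integers p" "y - x = of_nat p * (- c)"
    using assms(1) by (auto simp: p_integers_uminus algebra_simps)
  then show ?thesis
    using assms(2) unfolding rat_cong_def by blast
qed

lemma rat_cong_trans:
  assumes "prime p" "rat_cong p x y" "rat_cong p y z"
  shows "rat_cong p x z"
proof -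
  obtain c d where "c \<in> p_integers p" "x - y = of_nat p * c"
    and "d \<in> p_integers p" "y - z = of_nat p * d"
    using assms(2,3) by (auto simp: rat_cong_def)
  then have "c + d \<in> p_integers p" "x - z = of_nat p * (c + d)"
    using assms(1) by (auto simp: p_integers_add algebra_simps)
  then show ?thesis
    using assms(2,3) unfolding rat_cong_def by blast
qed

lemma rat_cong_sum:
  assumes "prime p" "\<And>i. i \<in> A \<Longrightarrow> rat_cong p (f i) (g i)"
  shows "rat_cong p (sum f A) (sum g A)"
  using assms(2)
proof (induction A rule: infinite_finite_induct)
  case (insert i A)
  then have "rat_cong p (f i) (g i)" "rat_cong p (sum f A) (sum g A)"
    by auto
  then obtain c d where "c \<in> p_integers p" "f i - g i = of_nat p * c"
    and "d \<in> p_integers p" "sum f A - sum g A = of_nat p * d"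
    by (auto simp: rat_cong_def)
  then have "c + d \<in> p_integers p"
    "(f i + sum f A) - (g i + sum g A) = of_nat p * (c + d)"
    using assms(1) by (auto simp: p_integers_add algebra_simps)
  then show ?case
    using insert.hyps assms(1) \<open>rat_cong p (f i) (g i)\<close> \<open>rat_cong p (sum f A) (sum g A)\<close>
    unfolding rat_cong_def by (auto simp: p_integers_add)
qed (use assms(1) p_integers_of_int[of p 0] in \<open>auto simp: rat_cong_def\<close>)

lemma rat_cong_divide:
  assumes "prime p" "\<not> int p dvd d" "[a = c * d] (mod int p)"
  shows "rat_cong p (of_int a / of_int d) (of_int c)"
proof -
  obtain m where "a - c * d = int p * m"
    using assms(3) by (auto simp: cong_iff_dvd_diff)
  then have "of_int (a - c * d) = (of_int (int p * m) :: rat)"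
    by (rule arg_cong)
  moreover have "d \<noteq> 0"
    using assms(2) by auto
  ultimately have "of_int a / of_int d - of_int c = (of_nat p :: rat) * (of_int m / of_int d)"
    by (simp add: field_simps)
  then show ?thesis
    unfolding rat_cong_def using assms(1,2) p_integers_of_int[OF assms(1)]
      p_integers_iff[OF assms(1)] by blast
qed

lemma rat_cong_of_int:
  assumes "prime p" "[a = b] (mod int p)"
  shows "rat_cong p (of_int a) (of_int b)"
  using rat_cong_divide[of p 1 a b] assms by (simp add: not_prime_1 prime_gt_1_nat) (metis not_prime_1 One_nat_def)

text \<open>The bridge from the rationals to \<open>int\<close>: as \<open>q\<close> is an inverse
  of \<open>d\<close> modulo \<open>p\<close>, division by \<open>d ^ k\<close> may be replaced by
  multiplication with \<open>q ^ k\<close>, and all further work is on integer congruences. The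
  existence of \<open>q\<close> also keeps \<open>p\<close> from dividing \<open>d\<close>, which
  gives p-integrality.\<close>

lemma rat_cong_sum_divide_power:
  assumes p: "prime p" and q: "[d * q = 1] (mod int p)"
    and S: "[(\<Sum>k\<in>A. c k * q ^ k) = S] (mod int p)"
  shows "rat_cong p (\<Sum>k\<in>A. of_int (c k) / of_int d ^ k) (of_int S)"
proof -
  have d: "\<not> int p dvd d ^ k" for k
  proof
    assume "int p dvd d ^ k"
    then have "int p dvd d"
      using p prime_dvd_power[of "int p" d k] by simp
    then have "int p dvd 1"
      using q by (metis cong_dvd_iff dvd_mult2)
    then show False
      using p by auto
  qed
  have "rat_cong p (of_int (c k) / of_int (d ^ k)) (of_int (c k * q ^ k))" for k
  proof (rule rat_cong_divide[OF p d])
    have "[c k * (d * q) ^ k = c k * 1 ^ k] (mod int p)"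
      by (intro cong_mult cong_pow cong_refl q)
    then show "[c k = c k * q ^ k * d ^ k] (mod int p)"
      by (simp add: power_mult_distrib cong_sym mult.assoc mult.commute mult.left_commute)
  qed
  then have "rat_cong p (\<Sum>k\<in>A. of_int (c k) / of_int (d ^ k)) (\<Sum>k\<in>A. of_int (c k * q ^ k))"
    by (intro rat_cong_sum p)
  also have "(\<Sum>k\<in>A. of_int (c k * q ^ k)) = (of_int (\<Sum>k\<in>A. c k * q ^ k) :: rat)"
    by simp
  finally have "rat_cong p (\<Sum>k\<in>A. of_int (c k) / of_int (d ^ k)) (of_int (\<Sum>k\<in>A. c k * q ^ k))" .
  from rat_cong_trans[OF p this rat_cong_of_int[OF p S]] show ?thesis
    by simp
qed

subsection \<open>Sums over a complete residue system\<close>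

lemma cong_mult_cancel_prime:
  fixes a b c :: int
  assumes "prime p" "\<not> int p dvd c" "[c * a = c * b] (mod int p)"
  shows "[a = b] (mod int p)"
  using assms by (metis cong_mult_lcancel coprime_commute prime_imp_coprime prime_nat_int_transfer)

lemma fermat_int:
  fixes a :: int
  assumes "prime p" "\<not> int p dvd a"
  shows "[a ^ (p - 1) = 1] (mod int p)"
proof -
  define b where "b = nat (a mod int p)"
  have p: "p > 0"
    using assms(1) prime_gt_0_nat by blast
  then have b: "int b = a mod int p"
    by (simp add: b_def)
  then have "\<not> p dvd b"
    using assms(2) by (metis dvd_mod_iff[OF dvd_refl] int_dvd_int_iff)
  then have "[int (b ^ (p - 1)) = int 1] (mod int p)"
    using fermat_theorem[OF assms(1)] cong_int_iff by blast
  then show ?thesis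
    using b by (simp add: cong_def power_mod)
qed

lemma bij_betw_affine_mod:
  fixes d e :: int
  assumes "prime p" "\<not> int p dvd d"
  shows "bij_betw (\<lambda>x. (d * x + e) mod int p) {0..<int p} {0..<int p}"
proof -
  have p: "int p > 0"
    using assms(1) prime_gt_0_nat by simp
  have inj: "inj_on (\<lambda>x. (d * x + e) mod int p) {0..<int p}"
  proof (rule inj_onI)
    fix x y assume xy: "x \<in> {0..<int p}" "y \<in> {0..<int p}"
      and "(d * x + e) mod int p = (d * y + e) mod int p"
    then have "[d * x = d * y] (mod int p)"
      by (simp add: cong_def[symmetric] cong_add_rcancel)
    then have "[x = y] (mod int p)"
      using assms cong_mult_cancel_prime by blast
    then show "x = y"
      using xy using cong_less_imp_eq_int[of x "int p" y] by simp
  qed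
  have "(\<lambda>x. (d * x + e) mod int p) ` {0..<int p} \<subseteq> {0..<int p}"
    using p by auto
  then show ?thesis
    using inj by (simp add: bij_betw_def endo_inj_surj)
qed

lemma sum_affine_mod:
  fixes d e :: int and f :: "int \<Rightarrow> 'a::comm_monoid_add"
  assumes "prime p" "\<not> int p dvd d"
    and f: "\<And>x. f (x mod int p) = f x"
  shows "(\<Sum>x\<in>{0..<int p}. f (d * x + e)) = (\<Sum>x\<in>{0..<int p}. f x)"
proof -
  have "(\<Sum>x\<in>{0..<int p}. f (d * x + e)) = (\<Sum>x\<in>{0..<int p}. f ((d * x + e) mod int p))"
    by (simp add: f)
  also have "\<dots> = (\<Sum>x\<in>{0..<int p}. f x)"
    by (rule sum.reindex_bij_betw[OF bij_betw_affine_mod[OF assms(1,2)]])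
  finally show ?thesis .
qed

text \<open>A function that respects congruence need not be periodic as an integer function.
  Reducing its values modulo \<open>p\<close> makes it so, and the exact reindexing
  \<open>sum_affine_mod\<close> applies.\<close>

lemma cong_sum_affine:
  fixes d e :: int and f :: "int \<Rightarrow> int"
  assumes "prime p" "\<not> int p dvd d"
    and f: "\<And>x y. [x = y] (mod int p) \<Longrightarrow> [f x = f y] (mod int p)"
  shows "[(\<Sum>x\<in>{0..<int p}. f (d * x + e)) = (\<Sum>x\<in>{0..<int p}. f x)] (mod int p)"
proof -
  have "(\<Sum>x\<in>{0..<int p}. f (d * x + e) mod int p) = (\<Sum>x\<in>{0..<int p}. f x mod int p)"
  proof (rule sum_affine_mod[OF assms(1,2), where f = "\<lambda>x. f x mod int p"])
    show "f (x mod int p) mod int p = f x mod int p" for x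
      by (rule f[unfolded cong_def, OF mod_mod_trivial])
  qed
  then show ?thesis
    unfolding cong_def by (metis mod_sum_eq)
qed

text \<open>A primitive root raised to the power (p-1)/m has exact order \<open>m\<close>.\<close>

lemma prime_root_of_unity_exists:
  assumes "prime p" "m > 1" "m dvd p - 1"
  obtains w where "[w ^ m = 1] (mod int p)" "\<And>i. 0 < i \<Longrightarrow> i < m \<Longrightarrow> \<not> [w ^ i = 1] (mod int p)"
proof -
  obtain g where g: "residue_primroot p g"
    using prime_primitive_root_exists[of p] assms(1) prime_gt_1_nat by blast
  then have ord: "ord p g = p - 1"
    using assms(1) by (simp add: residue_primroot_def totient_prime)
  obtain l where l: "p - 1 = m * l"
    using assms(3) by blast
  have "p > 1"
    using assms(1) prime_gt_1_nat by blast
  then have l0: "l > 0"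
    using l by (cases l) auto
  have iff: "[(int (g ^ l)) ^ i = 1] (mod int p) \<longleftrightarrow> m dvd i" for i
  proof -
    have "[(int (g ^ l)) ^ i = 1] (mod int p) \<longleftrightarrow> [int (g ^ (l * i)) = int 1] (mod int p)"
      by (simp add: power_mult)
    also have "\<dots> \<longleftrightarrow> [g ^ (l * i) = 1] (mod p)"
      by (simp only: cong_int_iff)
    also have "\<dots> \<longleftrightarrow> m * l dvd l * i"
      by (simp only: ord_divides ord l)
    also have "\<dots> \<longleftrightarrow> m dvd i"
      using l0 by (simp add: mult.commute)
    finally show ?thesis .
  qed
  show ?thesis
  proof (rule that[of "int (g ^ l)"])
    show "[int (g ^ l) ^ m = 1] (mod int p)"
      using iff[of m] by simp
    show "\<not> [int (g ^ l) ^ i = 1] (mod int p)" if "0 < i" "i < m" for i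
      using iff[of i] nat_dvd_not_less[OF that] by blast
  qed
qed

text \<open>If \<open>p - 1\<close> does not divide \<open>e\<close>, scaling by a primitive root
  \<open>g\<close> gives S = g^e S with g^e not congruent to 1. The condition \<open>e > 0\<close>
  matters: for \<open>e = 0\<close> the term 0^0 counts as 1 and the sum is \<open>p\<close>, not
  \<open>p - 1\<close>.\<close>

lemma cong_sum_power_residues:
  assumes "prime p"
  shows "[(\<Sum>x\<in>{0..<int p}. x ^ e) = (if e > 0 \<and> p - 1 dvd e then -1 else 0)] (mod int p)"
proof -
  have p: "p > 1"
    using assms(1) prime_gt_1_nat by blast
  consider "e = 0" | "e > 0" "p - 1 dvd e" | "e > 0" "\<not> p - 1 dvd e"
    by blast
  then show ?thesis
  proof cases
    case 1
    then show ?thesis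
      by (simp add: cong_0_iff)
  next
    case 2
    then obtain m where m: "e = (p - 1) * m"
      by blast
    have "[x ^ e = (if x = 0 then 0 else 1)] (mod int p)" if "x \<in> {0..<int p}" for x
    proof (cases "x = 0")
      case False
      then have "\<not> int p dvd x"
        using that zdvd_not_zless[of x "int p"] by auto
      then have "[(x ^ (p - 1)) ^ m = 1 ^ m] (mod int p)"
        using fermat_int[OF assms] by (intro cong_pow)
      then show ?thesis
        using False by (simp add: m power_mult)
    qed (use 2 in \<open>simp add: power_0_left\<close>)
    then have "[(\<Sum>x\<in>{0..<int p}. x ^ e) = (\<Sum>x\<in>{0..<int p}. if x = 0 then 0 else 1)] (mod int p)"
      by (intro cong_sum)
    also have "(\<Sum>x\<in>{0..<int p}. if x = 0 then 0 else 1) = (\<Sum>x\<in>{0..<int p} - {0}. 1::int)"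
      by (intro sum.mono_neutral_cong_right) auto
    also have "\<dots> = int p - 1"
      using p by (simp add: card_Diff_singleton of_nat_diff)
    also have "[int p - 1 = -1] (mod int p)"
      by (simp add: cong_iff_dvd_diff)
    finally show ?thesis
      using 2 by simp
  next
    case 3
    have "p - 1 > 1"
      using 3 p by (cases "p = 2") auto
    then obtain g where g: "[g ^ (p - 1) = 1] (mod int p)"
      "\<And>i. 0 < i \<Longrightarrow> i < p - 1 \<Longrightarrow> \<not> [g ^ i = 1] (mod int p)"
      by (rule prime_root_of_unity_exists[OF assms, of "p - 1"]) auto
    have gd: "\<not> int p dvd g"
    proof
      assume "int p dvd g"
      then have "int p dvd g ^ (p - 1)"
        using \<open>p - 1 > 1\<close> by (intro dvd_power_le[of _ _ 1, simplified]) auto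
      then have "int p dvd 1"
        using g(1) cong_dvd_iff by blast
      then show False
        using p by auto
    qed
    have ge: "\<not> [g ^ e = 1] (mod int p)"
    proof -
      define i where "i = e mod (p - 1)"
      have i: "0 < i" "i < p - 1"
        using 3 p by (auto simp: i_def mod_greater_zero_iff_not_dvd)
      have "[g ^ e = (g ^ (p - 1)) ^ (e div (p - 1)) * g ^ i] (mod int p)"
        by (simp add: i_def flip: power_add power_mult)
      also have "[(g ^ (p - 1)) ^ (e div (p - 1)) * g ^ i = 1 ^ (e div (p - 1)) * g ^ i] (mod int p)"
        by (intro cong_mult cong_pow g(1) cong_refl)
      finally show ?thesis
        using g(2)[OF i] by (metis cong_sym cong_trans mult_1 power_one)
    qed
    define S where "S = (\<Sum>x\<in>{0..<int p}. x ^ e)"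
    have "[(\<Sum>x\<in>{0..<int p}. (g * x + 0) ^ e) = S] (mod int p)"
      unfolding S_def by (rule cong_sum_affine[OF assms gd]) (rule cong_pow)
    moreover have "(\<Sum>x\<in>{0..<int p}. (g * x + 0) ^ e) = g ^ e * S"
      by (simp add: S_def power_mult_distrib sum_distrib_left)
    ultimately have "int p dvd (g ^ e - 1) * S"
      by (simp add: cong_iff_dvd_diff left_diff_distrib)
    moreover have "\<not> int p dvd g ^ e - 1"
      using ge by (simp add: cong_iff_dvd_diff)
    ultimately have "int p dvd S"
      using assms by (simp add: prime_dvd_mult_iff)
    then show ?thesis
      using 3 by (simp add: cong_0_iff S_def)
  qed
qed

subsection \<open>Binomial sums modulo a prime\<close>

lemma prime_choose_cong_0:
  assumes "prime p" "0 < k" "k < p"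
  shows "[int (p choose k) = 0] (mod int p)"
  using dvd_choose_prime[of k p] assms by (simp add: cong_0_iff)

text \<open>The interior of row \<open>p\<close> of Pascal's triangle vanishes modulo
  \<open>p\<close>, so neighbouring entries of row \<open>p - 1\<close> are opposite.\<close>

lemma choose_prime_minus_1_cong:
  assumes "prime p" "m < p"
  shows "[int ((p - 1) choose m) = (-1) ^ m] (mod int p)"
  using assms(2)
proof (induction m)
  case (Suc m)
  have "p = Suc (p - 1)"
    using Suc.prems by simp
  then have "p choose Suc m = ((p - 1) choose m) + ((p - 1) choose Suc m)"
    by (metis binomial_Suc_Suc)
  then have "int ((p - 1) choose Suc m) = int (p choose Suc m) - int ((p - 1) choose m)"
    by simp
  also have "[\<dots> = 0 - (-1) ^ m] (mod int p)"
    using Suc by (intro cong_diff prime_choose_cong_0[OF assms(1)]) auto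
  finally show ?case
    by simp
qed auto

text \<open>Pascal's rule, summed. For \<open>N = p\<close> the boundary term vanishes modulo
  \<open>p\<close> as long as \<open>Suc m < p\<close>.\<close>

lemma sum_choose_power_Suc:
  fixes t :: "'a::comm_ring_1"
  shows "(1 - t) * (\<Sum>n<N. of_nat (n choose Suc m) * t ^ n) =
    t * (\<Sum>n<N. of_nat (n choose m) * t ^ n) - of_nat (N choose Suc m) * t ^ N"
proof (induction N)
  case (Suc N)
  then show ?case
    by (simp only: sum.lessThan_Suc distrib_left) (simp add: algebra_simps)
qed simp

text \<open>The infinite series would be t^m / (1-t)^(m+1). Truncation at \<open>p\<close> removes
  one factor \<open>s\<close>: for \<open>m = 0\<close> the geometric sum is (1 - t^p) s, which is
  (1 - t) s = 1 by Fermat. Each step of the recursion then contributes a factor t s.\<close>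

lemma sum_choose_power_cong:
  fixes s t :: int
  assumes p: "prime p" and s: "[(1 - t) * s = 1] (mod int p)" and "m < p"
  shows "[(\<Sum>n<p. int (n choose m) * t ^ n) = (t * s) ^ m] (mod int p)"
  using assms(3)
proof (induction m)
  case 0
  have "[t ^ p = t] (mod int p)"
  proof (cases "int p dvd t")
    case True
    then show ?thesis
      using p prime_gt_0_nat[OF p] by (metis cong_0_iff cong_sym cong_trans dvd_power dvd_trans)
  next
    case False
    then have "[t * t ^ (p - 1) = t * 1] (mod int p)"
      using p by (intro cong_scalar_left fermat_int)
    then show ?thesis
      using prime_gt_0_nat[OF p] by (simp flip: power_Suc)
  qed
  then have "[s * (1 - t ^ p) = s * (1 - t)] (mod int p)"
    by (intro cong_scalar_left cong_diff cong_refl)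
  moreover have "1 - t ^ p = (1 - t) * (\<Sum>n<p. t ^ n)"
    by (rule one_diff_power_eq)
  ultimately have *: "[s * ((1 - t) * (\<Sum>n<p. t ^ n)) = s * (1 - t)] (mod int p)"
    by simp
  have "[1 * (\<Sum>n<p. t ^ n) = (1 - t) * s * (\<Sum>n<p. t ^ n)] (mod int p)"
    by (intro cong_scalar_right cong_sym[OF s])
  also have "(1 - t) * s * (\<Sum>n<p. t ^ n) = s * ((1 - t) * (\<Sum>n<p. t ^ n))"
    by simp
  also note *
  also have "s * (1 - t) = (1 - t) * s"
    by simp
  also note s
  finally show ?case
    by simp
next
  case (Suc m)
  define H where "H = (\<lambda>m. \<Sum>n<p. int (n choose m) * t ^ n)"
  have "[1 * H (Suc m) = (1 - t) * s * H (Suc m)] (mod int p)"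
    by (intro cong_scalar_right cong_sym[OF s])
  also have "(1 - t) * s * H (Suc m) = s * (t * H m - int (p choose Suc m) * t ^ p)"
    using sum_choose_power_Suc[where t = t and N = p and m = m]
    by (simp add: H_def mult.commute mult.left_commute)
  also have "[\<dots> = s * (t * (t * s) ^ m - 0 * t ^ p)] (mod int p)"
    using Suc prime_choose_cong_0[OF p, of "Suc m"] unfolding H_def
    by (intro cong_scalar_left cong_scalar_right cong_diff) auto
  finally show ?case
    by (simp add: H_def mult_ac)
qed

text \<open>C(2n,n) = (-4)^n C(-1/2,n), and -1/2 is congruent to \<open>h\<close>. The proof
  compares the first-order recurrences of both sides, multiplied by \<open>Suc n\<close>, which is a
  unit modulo \<open>p\<close> in this range.\<close>

lemma central_binomial_cong:
  assumes p: "prime p" and h: "p = 2 * h + 1" and "n < p"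
  shows "[int ((2 * n) choose n) = (-4) ^ n * int (h choose n)] (mod int p)"
  using assms(3)
proof (induction n)
  case (Suc n)
  have rec1: "int (Suc n) * int ((2 * Suc n) choose Suc n) = 2 * (2 * int n + 1) * int ((2 * n) choose n)"
  proof -
    have "Suc n * ((2 * Suc n) choose Suc n) = (2 * n + 2) * ((2 * n + 1) choose n)"
      using Suc_times_binomial_eq[of "2 * n + 1" n] by (simp add: mult.commute)
    moreover have "Suc n * ((2 * n + 1) choose n) = (2 * n + 1) * ((2 * n) choose n)"
    proof -
      have "(2 * n + 1) choose n = (2 * n + 1) choose Suc n"
        using binomial_symmetric[of n "2 * n + 1"] by simp
      then show ?thesis
        using Suc_times_binomial_eq[of "2 * n" n] by (simp add: mult.commute)
    qed
    ultimately have "Suc n * ((2 * Suc n) choose Suc n) = 2 * (2 * n + 1) * ((2 * n) choose n)"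
      by simp
    then have "int (Suc n * ((2 * Suc n) choose Suc n)) = int (2 * (2 * n + 1) * ((2 * n) choose n))"
      by (rule arg_cong)
    then show ?thesis
      by (simp only: of_nat_mult of_nat_add of_nat_numeral of_nat_1)
  qed
  have rec2: "int (Suc n) * int (h choose Suc n) = (int h - int n) * int (h choose n)"
  proof (cases "n \<le> h")
    case True
    have "Suc n * (h choose Suc n) = (h - n) * (h choose n)"
      by (simp only: binomial_absorption binomial_absorb_comp)
    then have "int (Suc n * (h choose Suc n)) = int ((h - n) * (h choose n))"
      by (rule arg_cong)
    then show ?thesis
      using True by (simp only: of_nat_mult of_nat_diff)
  qed (simp add: binomial_eq_0)
  have "int (Suc n) * int ((2 * Suc n) choose Suc n) = 2 * (2 * int n + 1) * int ((2 * n) choose n)"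
    by (rule rec1)
  also have "[\<dots> = 2 * (2 * int n + 1) * ((-4) ^ n * int (h choose n))] (mod int p)"
    using Suc by (intro cong_scalar_left) simp
  also have "[2 * (2 * int n + 1) * ((-4) ^ n * int (h choose n)) =
      (-4 * (int h - int n)) * ((-4) ^ n * int (h choose n))] (mod int p)"
  proof (rule cong_scalar_right)
    have "2 * (2 * int n + 1) - (-4 * (int h - int n)) = 2 * int p"
      by (simp add: h)
    then show "[2 * (2 * int n + 1) = -4 * (int h - int n)] (mod int p)"
      by (simp add: cong_iff_dvd_diff)
  qed
  also have "(-4 * (int h - int n)) * ((-4) ^ n * int (h choose n)) =
      (-4) ^ Suc n * ((int h - int n) * int (h choose n))"
    by (simp only: power_Suc mult_ac)
  also have "\<dots> = int (Suc n) * ((-4) ^ Suc n * int (h choose Suc n))"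
    unfolding rec2[symmetric] by (simp only: mult_ac)
  finally show ?case
  proof (rule cong_mult_cancel_prime[OF p, rotated])
    show "\<not> int p dvd int (Suc n)"
      using Suc.prems by (meson int_dvd_int_iff nat_dvd_not_less zero_less_Suc)
  qed
qed auto

text \<open>Binomial inversion: C(h,n) C(n,m) = C(h,m) C(h-m,n-m) reduces the sum to an alternating
  row sum, nonzero only for row h - m = 0.\<close>

lemma sum_choose_choose_alternating:
  assumes "h < N"
  shows "(\<Sum>n<N. (-1) ^ n * int (h choose n) * int (n choose m)) = (if m = h then (-1) ^ h else 0)"
proof (cases "m \<le> h")
  case True
  have "(\<Sum>n<N. (-1) ^ n * int (h choose n) * int (n choose m)) =
      (\<Sum>n=m..h. (-1) ^ n * int (h choose n) * int (n choose m))"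
    using assms by (intro sum.mono_neutral_right) (auto simp: not_le)
  also have "\<dots> = (\<Sum>n=m..h. (-1) ^ n * int (h choose m) * int ((h - m) choose (n - m)))"
  proof (rule sum.cong[OF refl])
    fix n assume "n \<in> {m..h}"
    then have "(h choose n) * (n choose m) = (h choose m) * ((h - m) choose (n - m))"
      by (intro choose_mult) auto
    then have "int (h choose n) * int (n choose m) = int (h choose m) * int ((h - m) choose (n - m))"
      by (metis of_nat_mult)
    then show "(-1) ^ n * int (h choose n) * int (n choose m) =
        (-1) ^ n * int (h choose m) * int ((h - m) choose (n - m))"
      by (simp add: mult.assoc)
  qed
  also have "\<dots> = (\<Sum>i\<le>h - m. (-1) ^ (i + m) * int (h choose m) * int ((h - m) choose i))"
    using True by (intro sum.reindex_bij_witness[of _ "\<lambda>i. i + m" "\<lambda>n. n - m"]) auto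
  also have "\<dots> = (-1) ^ m * int (h choose m) * (\<Sum>i\<le>h - m. (-1) ^ i * int ((h - m) choose i))"
    by (simp add: sum_distrib_left power_add mult_ac)
  also have "\<dots> = (if m = h then (-1) ^ h else 0)"
    using True choose_alternating_sum[of "h - m", where ?'a = int] by auto
  finally show ?thesis .
next
  case False
  then have "(-1) ^ n * int (h choose n) * int (n choose m) = 0" for n
    by (cases "n \<le> h") auto
  then have "(\<Sum>n<N. (-1) ^ n * int (h choose n) * int (n choose m)) = 0"
    by (intro sum.neutral) blast
  then show ?thesis
    using False by simp
qed

lemma prime_gt_3_mod_3:
  fixes p :: nat
  assumes "prime p" "p > 3"
  shows "p mod 3 = 1 \<or> p mod 3 = 2"
proof -
  have "p mod 3 \<noteq> 0"
    using assms by (metis dvd_eq_mod_eq_0 less_irrefl numeral_eq_one_iff prime_nat_iff semiring_norm(86))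
  then show ?thesis
    by linarith
qed

subsection \<open>Reduction of the sums over \<open>W\<close>\<close>

text \<open>The multinomial coefficient (3k)!/k!^3, in the division-free form that it has inside
  \<open>W\<close>.\<close>

definition trinomial_coeff :: "nat \<Rightarrow> int" where
  "trinomial_coeff k = int ((2 * k) choose k) * int ((3 * k) choose k)"

text \<open>A range for \<open>k\<close> independent of \<open>n\<close>, as the interchange of
  summations requires; the added terms have \<open>n choose (3 * k) = 0\<close>.\<close>

lemma W_eq_sum:
  assumes "n \<le> N"
  shows "W n = (\<Sum>k\<le>N div 3. trinomial_coeff k * (int (n choose (3 * k)) * (-3) ^ (n - 3 * k)))"
proof -
  have "W n = (\<Sum>k=0..n div 3. trinomial_coeff k * (int (n choose (3 * k)) * (-3) ^ (n - 3 * k)))"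
    by (simp add: W_def trinomial_coeff_def mult.assoc)
  also have "\<dots> = (\<Sum>k\<le>N div 3. trinomial_coeff k * (int (n choose (3 * k)) * (-3) ^ (n - 3 * k)))"
    using assms div_le_mono[OF assms, of 3] by (intro sum.mono_neutral_left) auto
  finally show ?thesis .
qed

text \<open>The exponent \<open>n - 3 * k\<close> couples the two summations. With \<open>v\<close>
  inverse to -3 it splits into \<open>v ^ (3 * k)\<close> and \<open>(-3) ^ n\<close>, after which
  each \<open>k\<close> carries an inner sum over \<open>n\<close> that has a closed form modulo
  \<open>p\<close> for the weights of interest.\<close>

lemma sum_W_cong:
  fixes c :: "nat \<Rightarrow> int"
  assumes v: "[-3 * v = 1] (mod m)"
  shows "[(\<Sum>n<N. c n * W n) =
    (\<Sum>k\<le>N div 3. trinomial_coeff k * v ^ (3 * k) * (\<Sum>n<N. c n * (-3) ^ n * int (n choose (3 * k))))] (mod m)"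
proof -
  have *: "[int (n choose j) * (-3) ^ (n - j) = v ^ j * (-3) ^ n * int (n choose j)] (mod m)" for n j
  proof (cases "j \<le> n")
    case True
    have "int (n choose j) * (-3) ^ (n - j) * 1 ^ j = int (n choose j) * (-3) ^ (n - j)"
      by simp
    moreover have "[int (n choose j) * (-3) ^ (n - j) * 1 ^ j =
        int (n choose j) * (-3) ^ (n - j) * (-3 * v) ^ j] (mod m)"
      by (intro cong_scalar_left cong_pow cong_sym[OF v])
    moreover have "int (n choose j) * (-3) ^ (n - j) * (-3 * v) ^ j =
        v ^ j * ((-3) ^ (n - j) * (-3) ^ j) * int (n choose j)"
      by (simp only: power_mult_distrib mult_ac)
    moreover have "(-3) ^ (n - j) * (-3) ^ j = ((-3) ^ n :: int)"
      using True by (simp flip: power_add)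
    ultimately show ?thesis
      by metis
  qed (simp add: binomial_eq_0)
  have "[(\<Sum>n<N. c n * W n) =
      (\<Sum>n<N. \<Sum>k\<le>N div 3. c n * trinomial_coeff k * (v ^ (3 * k) * (-3) ^ n * int (n choose (3 * k))))] (mod m)"
  proof (rule cong_sum)
    fix n assume "n \<in> {..<N}"
    then have "c n * W n = (\<Sum>k\<le>N div 3. c n * trinomial_coeff k * (int (n choose (3 * k)) * (-3) ^ (n - 3 * k)))"
      by (simp only: W_eq_sum[of n N] sum_distrib_left mult.assoc lessThan_iff less_imp_le)
    then show "[c n * W n =
        (\<Sum>k\<le>N div 3. c n * trinomial_coeff k * (v ^ (3 * k) * (-3) ^ n * int (n choose (3 * k))))] (mod m)"
      by (simp only:) (intro cong_sum cong_scalar_left *)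
  qed
  moreover have "(\<Sum>n<N. \<Sum>k\<le>N div 3. c n * trinomial_coeff k * (v ^ (3 * k) * (-3) ^ n * int (n choose (3 * k)))) =
      (\<Sum>k\<le>N div 3. trinomial_coeff k * v ^ (3 * k) * (\<Sum>n<N. c n * (-3) ^ n * int (n choose (3 * k))))"
    by (subst sum.swap) (simp only: sum_distrib_left mult_ac)
  ultimately show ?thesis
    by (simp only:)
qed

text \<open>The weight \<open>v ^ n\<close> cancels \<open>(-3) ^ n\<close>, so the inner sum is the
  hockey-stick sum C(p,3k+1), divisible by \<open>p\<close> unless 3k + 1 = p.\<close>

lemma sum_W_minus_3_cong:
  assumes p: "prime p" "p > 3" and v: "[-3 * v = 1] (mod int p)"
  shows "[(\<Sum>n<p. W n * v ^ n) =
    (if p mod 3 = 1 then trinomial_coeff (p div 3) * v ^ (3 * (p div 3)) else 0)] (mod int p)"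
proof -
  have "(\<Sum>n<p. W n * v ^ n) = (\<Sum>n<p. v ^ n * W n)"
    by (simp add: mult.commute)
  also have "[\<dots> = (\<Sum>k\<le>p div 3. trinomial_coeff k * v ^ (3 * k) *
      (\<Sum>n<p. v ^ n * (-3) ^ n * int (n choose (3 * k))))] (mod int p)"
    by (rule sum_W_cong[OF v])
  also have "[(\<Sum>k\<le>p div 3. trinomial_coeff k * v ^ (3 * k) * (\<Sum>n<p. v ^ n * (-3) ^ n * int (n choose (3 * k)))) =
      (\<Sum>k\<le>p div 3. if p mod 3 = 1 \<and> k = p div 3 then trinomial_coeff k * v ^ (3 * k) else 0)] (mod int p)"
  proof (rule cong_sum)
    fix k assume k: "k \<in> {..p div 3}"
    have "[v ^ n * (-3) ^ n * int (n choose (3 * k)) = int (n choose (3 * k))] (mod int p)" for n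
    proof -
      have "[(-3 * v) ^ n * int (n choose (3 * k)) = 1 ^ n * int (n choose (3 * k))] (mod int p)"
        by (intro cong_scalar_right cong_pow v)
      then show ?thesis
        by (simp only: power_mult_distrib power_one mult_1) (simp only: mult.commute)
    qed
    then have "[(\<Sum>n<p. v ^ n * (-3) ^ n * int (n choose (3 * k))) =
        (\<Sum>n<p. int (n choose (3 * k)))] (mod int p)"
      by (intro cong_sum)
    also have "(\<Sum>n<p. int (n choose (3 * k))) = int (p choose Suc (3 * k))"
      using sum_choose_upper[of "3 * k" "p - 1"] p(2)
      by (simp add: lessThan_Suc_atMost[symmetric] flip: of_nat_sum)
    also have "[int (p choose Suc (3 * k)) = (if p mod 3 = 1 \<and> k = p div 3 then 1 else 0)] (mod int p)"
    proof (cases "p mod 3 = 1 \<and> k = p div 3")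
      case True
      then have "Suc (3 * k) = p"
        using mult_div_mod_eq[of 3 p] by linarith
      then show ?thesis
        using True by simp
    next
      case False
      have "Suc (3 * k) < p"
        using k False prime_gt_3_mod_3[OF p] unfolding atMost_iff by presburger
      then show ?thesis
        using False prime_choose_cong_0[OF p(1), of "Suc (3 * k)"] by auto
    qed
    finally have "[trinomial_coeff k * v ^ (3 * k) * (\<Sum>n<p. v ^ n * (-3) ^ n * int (n choose (3 * k))) =
        trinomial_coeff k * v ^ (3 * k) * (if p mod 3 = 1 \<and> k = p div 3 then 1 else 0)] (mod int p)"
      by (intro cong_scalar_left)
    then show "[trinomial_coeff k * v ^ (3 * k) * (\<Sum>n<p. v ^ n * (-3) ^ n * int (n choose (3 * k))) =
        (if p mod 3 = 1 \<and> k = p div 3 then trinomial_coeff k * v ^ (3 * k) else 0)] (mod int p)"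
      by (cases "p mod 3 = 1 \<and> k = p div 3") (simp_all only: simp_thms if_True if_False mult_1_right mult_zero_right)
  qed
  also have "(\<Sum>k\<le>p div 3. if p mod 3 = 1 \<and> k = p div 3 then trinomial_coeff k * v ^ (3 * k) else 0) =
      (if p mod 3 = 1 then trinomial_coeff (p div 3) * v ^ (3 * (p div 3)) else 0)"
    by (cases "p mod 3 = 1") simp_all
  finally show ?thesis .
qed

lemma sum_W_minus_9_cong:
  assumes p: "prime p" "p > 3" and u: "[-9 * u = 1] (mod int p)"
    and r: "[-6 * r = 1] (mod int p)"
  shows "[(\<Sum>n<p. W n * u ^ n) = (\<Sum>k\<le>p div 3. trinomial_coeff k * r ^ (3 * k))] (mod int p)"
proof -
  \<comment> \<open>Modulo \<open>p\<close> these are v = -1/3, t = (-3)/(-9) = 1/3 and s = 1/(1-t)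
    = 3/2. The closed form of the inner sum then yields (v t s)^(3k) with v t s = -1/6 = r.\<close>
  define v t s where "v = 3 * u" and "t = -3 * u" and "s = -9 * r"
  have v: "[-3 * v = 1] (mod int p)"
    using u by (simp add: v_def)
  have s: "[(1 - t) * s = 1] (mod int p)"
  proof -
    have "(1 - t) * s - 1 = 3 * r * (-9 * u - 1) + (-6 * r - 1)"
      by (simp add: t_def s_def algebra_simps)
    then show ?thesis
      using u r by (metis cong_iff_dvd_diff dvd_add dvd_mult)
  qed
  have vts: "[v * (t * s) = r] (mod int p)"
  proof -
    have "v * (t * s) - r = (1 - 9 * u) * r * (-9 * u - 1)"
      by (simp add: v_def t_def s_def algebra_simps)
    then show ?thesis
      using u by (metis cong_iff_dvd_diff dvd_mult)
  qed
  have "(\<Sum>n<p. W n * u ^ n) = (\<Sum>n<p. u ^ n * W n)"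
    by (simp add: mult.commute)
  also have "[\<dots> = (\<Sum>k\<le>p div 3. trinomial_coeff k * v ^ (3 * k) *
      (\<Sum>n<p. u ^ n * (-3) ^ n * int (n choose (3 * k))))] (mod int p)"
    by (rule sum_W_cong[OF v])
  also have "[(\<Sum>k\<le>p div 3. trinomial_coeff k * v ^ (3 * k) * (\<Sum>n<p. u ^ n * (-3) ^ n * int (n choose (3 * k)))) =
      (\<Sum>k\<le>p div 3. trinomial_coeff k * r ^ (3 * k))] (mod int p)"
  proof (rule cong_sum)
    fix k assume "k \<in> {..p div 3}"
    then have "3 * k < p"
      using prime_gt_3_mod_3[OF p] unfolding atMost_iff by presburger
    then have "[(\<Sum>n<p. int (n choose (3 * k)) * t ^ n) = (t * s) ^ (3 * k)] (mod int p)"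
      by (rule sum_choose_power_cong[OF p(1) s])
    also have "(\<Sum>n<p. int (n choose (3 * k)) * t ^ n) =
        (\<Sum>n<p. u ^ n * (-3) ^ n * int (n choose (3 * k)))"
      by (simp only: t_def power_mult_distrib mult_ac)
    finally have "[trinomial_coeff k * v ^ (3 * k) * (\<Sum>n<p. u ^ n * (-3) ^ n * int (n choose (3 * k))) =
        trinomial_coeff k * v ^ (3 * k) * (t * s) ^ (3 * k)] (mod int p)"
      by (intro cong_scalar_left)
    also have "trinomial_coeff k * v ^ (3 * k) * (t * s) ^ (3 * k) = trinomial_coeff k * (v * (t * s)) ^ (3 * k)"
      by (simp only: power_mult_distrib mult_ac)
    also have "[\<dots> = trinomial_coeff k * r ^ (3 * k)] (mod int p)"
      by (intro cong_scalar_left cong_pow vts)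
    finally show "[trinomial_coeff k * v ^ (3 * k) * (\<Sum>n<p. u ^ n * (-3) ^ n * int (n choose (3 * k))) =
        trinomial_coeff k * r ^ (3 * k)] (mod int p)" .
  qed
  finally show ?thesis .
qed

text \<open>The weights combine to (-4)(-3)/(-12) = -1, which makes the inner sum the alternating
  one of \<open>sum_choose_choose_alternating\<close>; only 3k = h survives. The remaining
  \<open>- 4 * q\<close> is an inverse of 3.\<close>

lemma sum_binomial_W_minus_12_cong:
  assumes p: "prime p" and h: "p = 2 * h + 1" and q: "[-12 * q = 1] (mod int p)"
  shows "[(\<Sum>n<p. int ((2 * n) choose n) * W n * q ^ n) =
    (if 3 dvd h then trinomial_coeff (h div 3) * (- 4 * q) ^ h else 0)] (mod int p)"
proof -
  define v where "v = 4 * q"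
  have v: "[-3 * v = 1] (mod int p)"
    using q by (simp add: v_def)
  have "(\<Sum>n<p. int ((2 * n) choose n) * W n * q ^ n) =
      (\<Sum>n<p. int ((2 * n) choose n) * q ^ n * W n)"
    by (simp add: mult_ac)
  also have "[\<dots> = (\<Sum>k\<le>p div 3. trinomial_coeff k * v ^ (3 * k) *
      (\<Sum>n<p. int ((2 * n) choose n) * q ^ n * (-3) ^ n * int (n choose (3 * k))))] (mod int p)"
    by (rule sum_W_cong[OF v])
  also have "[(\<Sum>k\<le>p div 3. trinomial_coeff k * v ^ (3 * k) *
      (\<Sum>n<p. int ((2 * n) choose n) * q ^ n * (-3) ^ n * int (n choose (3 * k)))) =
      (\<Sum>k\<le>p div 3. trinomial_coeff k * v ^ (3 * k) * (if 3 * k = h then (-1) ^ h else 0))] (mod int p)"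
  proof (rule cong_sum, rule cong_scalar_left)
    fix k
    have "[int ((2 * n) choose n) * q ^ n * (-3) ^ n * int (n choose (3 * k)) =
        (-1) ^ n * int (h choose n) * int (n choose (3 * k))] (mod int p)" if "n < p" for n
    proof -
      have "[int ((2 * n) choose n) * (q ^ n * (-3) ^ n * int (n choose (3 * k))) =
          (-4) ^ n * int (h choose n) * (q ^ n * (-3) ^ n * int (n choose (3 * k)))] (mod int p)"
        by (intro cong_scalar_right central_binomial_cong[OF p h that])
      also have "(-4) ^ n * int (h choose n) * (q ^ n * (-3) ^ n * int (n choose (3 * k))) =
          (-1 * (-12 * q)) ^ n * (int (h choose n) * int (n choose (3 * k)))"
      proof -
        have "(-4) ^ n * q ^ n * (-3) ^ n = (-1 * (-12 * q)) ^ n"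
          unfolding power_mult_distrib[symmetric] by (rule arg_cong[where f = "\<lambda>x. x ^ n"]) simp
        moreover have "(-4) ^ n * int (h choose n) * (q ^ n * (-3) ^ n * int (n choose (3 * k))) =
            ((-4) ^ n * q ^ n * (-3) ^ n) * (int (h choose n) * int (n choose (3 * k)))"
          by (simp only: mult_ac)
        ultimately show ?thesis
          by (simp only:)
      qed
      also have "[(-1 * (-12 * q)) ^ n * (int (h choose n) * int (n choose (3 * k))) =
          (-1 * 1) ^ n * (int (h choose n) * int (n choose (3 * k)))] (mod int p)"
        by (intro cong_scalar_right cong_pow cong_scalar_left q)
      finally show ?thesis
        by (simp add: mult.assoc)
    qed
    then have "[(\<Sum>n<p. int ((2 * n) choose n) * q ^ n * (-3) ^ n * int (n choose (3 * k))) =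
        (\<Sum>n<p. (-1) ^ n * int (h choose n) * int (n choose (3 * k)))] (mod int p)"
      by (intro cong_sum) auto
    then show "[(\<Sum>n<p. int ((2 * n) choose n) * q ^ n * (-3) ^ n * int (n choose (3 * k))) =
        (if 3 * k = h then (-1) ^ h else 0)] (mod int p)"
      using sum_choose_choose_alternating[of h p "3 * k"] h by simp
  qed
  also have "(\<Sum>k\<le>p div 3. trinomial_coeff k * v ^ (3 * k) * (if 3 * k = h then (-1) ^ h else 0)) =
      (\<Sum>k\<le>p div 3. if k = h div 3 then (if 3 dvd h then trinomial_coeff (h div 3) * (- 4 * q) ^ h else 0) else 0)"
  proof (rule sum.cong[OF refl])
    fix k
    have "v ^ h * (-1) ^ h = (- 4 * q) ^ h"
      unfolding power_mult_distrib[symmetric] by (simp add: v_def)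
    moreover have "3 * k = h \<longleftrightarrow> k = h div 3 \<and> 3 dvd h"
      by auto
    ultimately show "trinomial_coeff k * v ^ (3 * k) * (if 3 * k = h then (-1) ^ h else 0) =
        (if k = h div 3 then (if 3 dvd h then trinomial_coeff (h div 3) * (- 4 * q) ^ h else 0) else 0)"
      by (cases "3 * k = h") (auto simp: mult.assoc)
  qed
  also have "\<dots> = (if 3 dvd h then trinomial_coeff (h div 3) * (- 4 * q) ^ h else 0)"
    using h by (simp add: div_le_mono)
  finally show ?thesis .
qed

subsection \<open>Power sums of ternary cubic forms\<close>

text \<open>Power sum of a member of the Hesse pencil. Modulo \<open>p\<close> it is the negative of
  the Hasse invariant of the cubic, as each of the three variables contributes a factor -1.\<close>

definition hesse_sum :: "nat \<Rightarrow> int \<Rightarrow> int" where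
  "hesse_sum p c = (\<Sum>x\<in>{0..<int p}. \<Sum>y\<in>{0..<int p}. \<Sum>z\<in>{0..<int p}.
     (x ^ 3 + y ^ 3 + z ^ 3 + c * (x * y * z)) ^ (p - 1))"

lemma sum_swap2:
  "(\<Sum>x\<in>X. \<Sum>y\<in>Y. \<Sum>z\<in>Z. f x y z) = (\<Sum>z\<in>Z. \<Sum>x\<in>X. \<Sum>y\<in>Y. f x y z)"
  by (subst sum.swap[of _ Z Y]) (rule sum.swap)

lemma sum_swap3:
  "(\<Sum>x\<in>X. \<Sum>y\<in>Y. \<Sum>z\<in>Z. \<Sum>j\<in>J. f x y z j) =
   (\<Sum>j\<in>J. \<Sum>x\<in>X. \<Sum>y\<in>Y. \<Sum>z\<in>Z. f x y z j)"
  by (subst sum.swap[of _ J Z], subst sum.swap[of _ J Y], rule sum.swap)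

lemma trinomial_expansion:
  fixes x y z :: "'a::comm_semiring_1"
  shows "(x + y + z) ^ j = (\<Sum>i\<le>j. \<Sum>l\<le>j - i.
    of_nat (j choose i) * of_nat ((j - i) choose l) * (x ^ i * y ^ l * z ^ (j - i - l)))"
proof -
  have "(x + y + z) ^ j = (x + (y + z)) ^ j"
    by (simp add: add.assoc)
  then show ?thesis
    by (simp only: binomial_ring[of _ "y + z"] binomial_ring[of y z] sum_distrib_left mult_ac)
qed

text \<open>The exponents of the three variables add up to 3(p-1), and a nonzero contribution needs
  each of them to be a positive multiple of \<open>p - 1\<close>. So all three equal
  \<open>p - 1\<close>, which means i = l = j/3.\<close>

lemma cong_sum_monomial:
  assumes p: "prime p" and ijl: "i + l \<le> j" "j \<le> p - 1"
  shows "[(\<Sum>x\<in>{0..<int p}. \<Sum>y\<in>{0..<int p}. \<Sum>z\<in>{0..<int p}.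
      (x ^ 3) ^ i * (y ^ 3) ^ l * (z ^ 3) ^ (j - i - l) * (x * y * z) ^ (p - 1 - j)) =
    (if 3 * i = j \<and> 3 * l = j then -1 else 0)] (mod int p)"
proof -
  define m where "m = p - 1 - j"
  define P where "P = (\<lambda>e. \<Sum>x\<in>{0..<int p}. x ^ e)"
  define P' where "P' = (\<lambda>e. if e > 0 \<and> p - 1 dvd e then -1 else 0 :: int)"
  have PP': "[P e = P' e] (mod int p)" for e
    unfolding P_def P'_def by (rule cong_sum_power_residues[OF p])
  have "p - 1 > 0"
    using prime_gt_1_nat[OF p] by simp
  have "(\<Sum>x\<in>{0..<int p}. \<Sum>y\<in>{0..<int p}. \<Sum>z\<in>{0..<int p}.
      (x ^ 3) ^ i * (y ^ 3) ^ l * (z ^ 3) ^ (j - i - l) * (x * y * z) ^ m) =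
    (\<Sum>x\<in>{0..<int p}. \<Sum>y\<in>{0..<int p}. \<Sum>z\<in>{0..<int p}.
      x ^ (3 * i + m) * (y ^ (3 * l + m) * z ^ (3 * (j - i - l) + m)))"
    by (simp add: power_add power_mult_distrib mult_ac flip: power_mult)
  also have "\<dots> = P (3 * i + m) * (P (3 * l + m) * P (3 * (j - i - l) + m))"
    by (simp only: P_def flip: sum_distrib_left sum_distrib_right)
  also have "[\<dots> = P' (3 * i + m) * (P' (3 * l + m) * P' (3 * (j - i - l) + m))] (mod int p)"
    by (intro cong_mult PP')
  also have "P' (3 * i + m) * (P' (3 * l + m) * P' (3 * (j - i - l) + m)) =
      (if 3 * i = j \<and> 3 * l = j then -1 else 0)"
  proof (cases "3 * i = j \<and> 3 * l = j")
    case True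
    then have "3 * i + m = p - 1" "3 * l + m = p - 1" "3 * (j - i - l) + m = p - 1"
      using ijl by (auto simp: m_def)
    then show ?thesis
      using True \<open>p - 1 > 0\<close> by (simp add: P'_def)
  next
    case False
    have "P' (3 * i + m) * (P' (3 * l + m) * P' (3 * (j - i - l) + m)) = 0"
    proof (rule ccontr)
      assume "\<not> ?thesis"
      then have *: "0 < 3 * i + m" "p - 1 dvd 3 * i + m" "0 < 3 * l + m" "p - 1 dvd 3 * l + m"
        "0 < 3 * (j - i - l) + m" "p - 1 dvd 3 * (j - i - l) + m"
        by (auto simp: P'_def split: if_splits)
      then have "p - 1 \<le> 3 * i + m" "p - 1 \<le> 3 * l + m" "p - 1 \<le> 3 * (j - i - l) + m"
        by (auto intro: dvd_imp_le)
      moreover have "(3 * i + m) + (3 * l + m) + (3 * (j - i - l) + m) = 3 * (p - 1)"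
        using ijl by (simp add: m_def)
      ultimately have "3 * i + m = p - 1" "3 * l + m = p - 1"
        by linarith+
      then show False
        using False ijl by (auto simp: m_def)
    qed
    then show ?thesis
      using False by (simp only: if_False)
  qed
  finally show ?thesis
    by (simp only: m_def)
qed

text \<open>In the expansion \<open>j\<close> counts the factors from which a cube is taken,
  \<open>i\<close> and \<open>l\<close> those that give x^3 and y^3. Only i = l = j - i - l
  survives, so j = 3k and the multinomial coefficient is \<open>trinomial_coeff k\<close>.\<close>

lemma hesse_sum_cong:
  assumes p: "prime p"
  shows "[hesse_sum p c =
    - (\<Sum>k\<le>(p - 1) div 3. trinomial_coeff k * int ((p - 1) choose (3 * k)) * c ^ (p - 1 - 3 * k))] (mod int p)"
proof -
  let ?F = "{0..<int p}"
  define B where "B = (\<lambda>j i l. int ((p - 1) choose j) * c ^ (p - 1 - j) *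
    (int (j choose i) * int ((j - i) choose l)))"
  define M where "M = (\<lambda>j i l x y z. (x ^ 3) ^ i * (y ^ 3) ^ l * (z ^ 3) ^ (j - i - l) *
    (x * y * z) ^ (p - 1 - j) :: int)"
  have "(x ^ 3 + y ^ 3 + z ^ 3 + c * (x * y * z)) ^ (p - 1) =
      (\<Sum>j\<le>p - 1. \<Sum>i\<le>j. \<Sum>l\<le>j - i. B j i l * M j i l x y z)" for x y z
  proof -
    have "(x ^ 3 + y ^ 3 + z ^ 3 + c * (x * y * z)) ^ (p - 1) =
      (\<Sum>j\<le>p - 1. int ((p - 1) choose j) * (x ^ 3 + y ^ 3 + z ^ 3) ^ j *
        (c * (x * y * z)) ^ (p - 1 - j))"
      by (rule binomial_ring)
    then show ?thesis
      by (simp only: trinomial_expansion sum_distrib_left sum_distrib_right B_def M_def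
          power_mult_distrib[of c] mult_ac of_nat_id)
  qed
  then have "hesse_sum p c = (\<Sum>x\<in>?F. \<Sum>y\<in>?F. \<Sum>z\<in>?F.
      \<Sum>j\<le>p - 1. \<Sum>i\<le>j. \<Sum>l\<le>j - i. B j i l * M j i l x y z)"
    by (simp add: hesse_sum_def)
  also have "\<dots> = (\<Sum>j\<le>p - 1. \<Sum>i\<le>j. \<Sum>l\<le>j - i.
      \<Sum>x\<in>?F. \<Sum>y\<in>?F. \<Sum>z\<in>?F. B j i l * M j i l x y z)"
    by (simp only: sum_swap3[where X = ?F and Y = ?F and Z = ?F])
  also have "\<dots> = (\<Sum>j\<le>p - 1. \<Sum>i\<le>j. \<Sum>l\<le>j - i.
      B j i l * (\<Sum>x\<in>?F. \<Sum>y\<in>?F. \<Sum>z\<in>?F. M j i l x y z))"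
    by (simp add: sum_distrib_left)
  finally have 1: "[hesse_sum p c = (\<Sum>j\<le>p - 1. \<Sum>i\<le>j. \<Sum>l\<le>j - i.
      B j i l * (if 3 * i = j \<and> 3 * l = j then -1 else 0))] (mod int p)"
    by (simp only: M_def) (intro cong_sum cong_scalar_left cong_sum_monomial p; simp)
  have "(\<Sum>j\<le>p - 1. \<Sum>i\<le>j. \<Sum>l\<le>j - i.
      B j i l * (if 3 * i = j \<and> 3 * l = j then -1 else 0)) =
      (\<Sum>j\<le>p - 1. if 3 dvd j then - B j (j div 3) (j div 3) else 0)"
  proof (rule sum.cong[OF refl])
    fix j
    define D where "D = (if 3 dvd j then - B j (j div 3) (j div 3) else 0)"
    have "B j i l * (if 3 * i = j \<and> 3 * l = j then -1 else 0) =
        (if l = j div 3 then (if i = j div 3 then D else 0) else 0)" for i l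
    proof (cases "3 dvd j")
      case True
      then obtain k where "j = 3 * k"
        by blast
      then show ?thesis
        by (simp add: D_def)
    next
      case False
      then have "3 * i \<noteq> j"
        by auto
      then show ?thesis
        using False by (simp add: D_def)
    qed
    then have "(\<Sum>i\<le>j. \<Sum>l\<le>j - i. B j i l * (if 3 * i = j \<and> 3 * l = j then -1 else 0)) =
        (\<Sum>i\<le>j. \<Sum>l\<le>j - i. if l = j div 3 then (if i = j div 3 then D else 0) else 0)"
      by (simp only:)
    also have "\<dots> = (\<Sum>i\<le>j. if i = j div 3 then D else 0)"
    proof (rule sum.cong[OF refl])
      fix i assume "i \<in> {..j}"
      \<comment> \<open>Ensures that \<open>l = j div 3\<close> lies in the summation range when
        \<open>i = j div 3\<close>.\<close>
      have "j div 3 \<le> j - j div 3"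
        by linarith
      then show "(\<Sum>l\<le>j - i. if l = j div 3 then (if i = j div 3 then D else 0) else 0) =
          (if i = j div 3 then D else 0)"
        by (auto simp: sum.delta)
    qed
    also have "\<dots> = D"
      by (simp add: sum.delta)
    finally show "(\<Sum>i\<le>j. \<Sum>l\<le>j - i. B j i l * (if 3 * i = j \<and> 3 * l = j then -1 else 0)) =
        (if 3 dvd j then - B j (j div 3) (j div 3) else 0)"
      by (simp only: D_def)
  qed
  also have "\<dots> = (\<Sum>j | j \<le> p - 1 \<and> 3 dvd j. - B j (j div 3) (j div 3))"
    by (simp add: sum.inter_filter[symmetric])
  also have "\<dots> = (\<Sum>k\<le>(p - 1) div 3. - B (3 * k) k k)"
    by (intro sum.reindex_bij_witness[of _ "\<lambda>k. 3 * k" "\<lambda>j. j div 3"]) auto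
  also have "\<dots> = - (\<Sum>k\<le>(p - 1) div 3. trinomial_coeff k * int ((p - 1) choose (3 * k)) * c ^ (p - 1 - 3 * k))"
    by (simp add: B_def trinomial_coeff_def sum_negf mult_ac)
  finally show ?thesis
    using 1 by (simp only:)
qed

text \<open>The substitutions x = a + z, y = b + z and s = 3z + a + b reindex one variable each, the
  last because \<open>p\<close> does not divide 3; the factor 3 in front of the form disappears by
  3^(p-1) = 1. All coefficients lie in F_p, so the outcome serves both classes of \<open>p\<close>
  modulo 3.\<close>

lemma hesse_sum_6_cong:
  assumes p: "prime p" "p > 3"
  shows "[hesse_sum p 6 = (\<Sum>a\<in>{0..<int p}. \<Sum>b\<in>{0..<int p}. \<Sum>s\<in>{0..<int p}.
    (s ^ 3 + (2 * a ^ 3 - 3 * a ^ 2 * b - 3 * a * b ^ 2 + 2 * b ^ 3)) ^ (p - 1))] (mod int p)"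
proof -
  let ?F = "{0..<int p}"
  define f where "f = (\<lambda>x y z :: int. (x ^ 3 + y ^ 3 + z ^ 3 + 6 * (x * y * z)) ^ (p - 1))"
  define g where "g = (\<lambda>a b s :: int.
    (s ^ 3 + (2 * a ^ 3 - 3 * a ^ 2 * b - 3 * a * b ^ 2 + 2 * b ^ 3)) ^ (p - 1))"
  have 3: "\<not> int p dvd 3"
    using p zdvd_imp_le[of "int p" 3] by auto
  have fcong: "[f x y z = f x' y' z'] (mod int p)"
    if "[x = x'] (mod int p)" "[y = y'] (mod int p)" "[z = z'] (mod int p)" for x y z x' y' z'
    unfolding f_def using that by (intro cong_pow cong_add cong_mult cong_refl)
  have gcong: "[g a b s = g a b s'] (mod int p)" if "[s = s'] (mod int p)" for a b s s'
    unfolding g_def using that by (intro cong_pow cong_add cong_refl)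
  have 1: "hesse_sum p 6 = (\<Sum>z\<in>?F. \<Sum>x\<in>?F. \<Sum>y\<in>?F. f x y z)"
    unfolding hesse_sum_def f_def by (rule sum_swap2)
  have 2: "[(\<Sum>z\<in>?F. \<Sum>x\<in>?F. \<Sum>y\<in>?F. f x y z) =
      (\<Sum>z\<in>?F. \<Sum>a\<in>?F. \<Sum>b\<in>?F. f (a + z) (b + z) z)] (mod int p)"
  proof (rule cong_sum)
    fix z
    have "[(\<Sum>x\<in>?F. \<Sum>y\<in>?F. f x y z) = (\<Sum>a\<in>?F. \<Sum>y\<in>?F. f (1 * a + z) y z)] (mod int p)"
      by (rule cong_sym, rule cong_sum_affine[where f = "\<lambda>x. \<Sum>y\<in>?F. f x y z"])
        (use p in \<open>auto intro!: cong_sum fcong\<close>)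
    moreover have "[(\<Sum>a\<in>?F. \<Sum>y\<in>?F. f (1 * a + z) y z) =
        (\<Sum>a\<in>?F. \<Sum>b\<in>?F. f (1 * a + z) (1 * b + z) z)] (mod int p)"
      by (rule cong_sum, rule cong_sym, rule cong_sum_affine) (use p in \<open>auto intro!: fcong\<close>)
    ultimately show "[(\<Sum>x\<in>?F. \<Sum>y\<in>?F. f x y z) =
        (\<Sum>a\<in>?F. \<Sum>b\<in>?F. f (a + z) (b + z) z)] (mod int p)"
      unfolding mult_1 by (rule cong_trans)
  qed
  have 4: "(\<Sum>z\<in>?F. \<Sum>a\<in>?F. \<Sum>b\<in>?F. f (a + z) (b + z) z) =
      (\<Sum>a\<in>?F. \<Sum>b\<in>?F. \<Sum>z\<in>?F. f (a + z) (b + z) z)"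
    by (rule sum_swap2[symmetric])
  have 5: "[(\<Sum>a\<in>?F. \<Sum>b\<in>?F. \<Sum>z\<in>?F. f (a + z) (b + z) z) =
      (\<Sum>a\<in>?F. \<Sum>b\<in>?F. \<Sum>s\<in>?F. g a b s)] (mod int p)"
  proof (rule cong_sum, rule cong_sum)
    fix a b
    have "[f (a + z) (b + z) z = g a b (3 * z + (a + b))] (mod int p)" for z
    proof -
      have *: "3 * ((a + z) ^ 3 + (b + z) ^ 3 + z ^ 3 + 6 * ((a + z) * (b + z) * z)) =
          (3 * z + (a + b)) ^ 3 + (2 * a ^ 3 - 3 * a ^ 2 * b - 3 * a * b ^ 2 + 2 * b ^ 3)"
        by (simp add: power2_eq_square power3_eq_cube algebra_simps)
      have "[1 * f (a + z) (b + z) z = 3 ^ (p - 1) * f (a + z) (b + z) z] (mod int p)"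
        by (rule cong_scalar_right, rule cong_sym, rule fermat_int[OF p(1) 3])
      moreover have "3 ^ (p - 1) * f (a + z) (b + z) z = g a b (3 * z + (a + b))"
        unfolding f_def g_def power_mult_distrib[symmetric] * by (rule refl)
      ultimately show ?thesis
        by simp
    qed
    then have "[(\<Sum>z\<in>?F. f (a + z) (b + z) z) = (\<Sum>z\<in>?F. g a b (3 * z + (a + b)))] (mod int p)"
      by (intro cong_sum)
    moreover have "[(\<Sum>z\<in>?F. g a b (3 * z + (a + b))) = (\<Sum>s\<in>?F. g a b s)] (mod int p)"
      using gcong by (intro cong_sum_affine p 3)
    ultimately show "[(\<Sum>z\<in>?F. f (a + z) (b + z) z) = (\<Sum>s\<in>?F. g a b s)] (mod int p)"
      by (rule cong_trans)
  qed
  show ?thesis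
    using 2 5 unfolding 1 4 g_def by (rule cong_trans)
qed

lemma cong_sum_cube:
  fixes f :: "int \<Rightarrow> int"
  assumes p: "prime p" "p mod 3 = 2"
    and f: "\<And>x y. [x = y] (mod int p) \<Longrightarrow> [f x = f y] (mod int p)"
  shows "[(\<Sum>x\<in>{0..<int p}. f (x ^ 3)) = (\<Sum>x\<in>{0..<int p}. f x)] (mod int p)"
proof -
  \<comment> \<open>The inverse of 3 modulo \<open>p - 1\<close>: raising to the power
    \<open>k\<close> undoes cubing, since 3k = 1 + 2(p - 1).\<close>
  define k where "k = 2 * (p div 3) + 1"
  have "p = 3 * (p div 3) + 2"
    using p(2) by presburger
  then have k: "3 * k = 1 + 2 * (p - 1)"
    by (simp add: k_def)
  have root: "[(x ^ 3) ^ k = x] (mod int p)" for x :: int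
  proof (cases "int p dvd x")
    case True
    moreover have "x dvd x ^ (3 * k)"
      by (rule dvd_power) (simp add: k_def)
    ultimately have "int p dvd (x ^ 3) ^ k"
      using dvd_trans unfolding power_mult by blast
    then show ?thesis
      using True by (metis cong_0_iff cong_sym cong_trans)
  next
    case False
    have "[x * (x ^ (p - 1)) ^ 2 = x * 1 ^ 2] (mod int p)"
      by (intro cong_scalar_left cong_pow fermat_int p False)
    moreover have "(x ^ 3) ^ k = x * (x ^ (p - 1)) ^ 2"
      by (simp only: k power_add power_one_right mult.commute[of "p - 1" 2] flip: power_mult)
    ultimately show ?thesis
      by simp
  qed
  have "inj_on (\<lambda>x. x ^ 3 mod int p) {0..<int p}"
  proof (rule inj_onI)
    fix x y assume xy: "x \<in> {0..<int p}" "y \<in> {0..<int p}" "x ^ 3 mod int p = y ^ 3 mod int p"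
    then have "[(x ^ 3) ^ k = (y ^ 3) ^ k] (mod int p)"
      by (intro cong_pow[of "x ^ 3" "y ^ 3"]) (simp add: cong_def)
    from cong_trans[OF cong_sym[OF root] cong_trans[OF this root]] have "[x = y] (mod int p)" .
    then show "x = y"
      using xy cong_less_imp_eq_int[of x "int p" y] by simp
  qed
  moreover have "(\<lambda>x. x ^ 3 mod int p) ` {0..<int p} \<subseteq> {0..<int p}"
    using prime_gt_0_nat[OF p(1)] by auto
  ultimately have "bij_betw (\<lambda>x. x ^ 3 mod int p) {0..<int p} {0..<int p}"
    by (simp add: bij_betw_def endo_inj_surj)
  then have "(\<Sum>x\<in>{0..<int p}. f (x ^ 3 mod int p)) = (\<Sum>x\<in>{0..<int p}. f x)"
    by (rule sum.reindex_bij_betw)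
  moreover have "[(\<Sum>x\<in>{0..<int p}. f (x ^ 3)) = (\<Sum>x\<in>{0..<int p}. f (x ^ 3 mod int p))] (mod int p)"
    by (intro cong_sum f) simp
  ultimately show ?thesis
    by simp
qed

text \<open>For fixed \<open>a\<close> and \<open>b\<close> the sum over \<open>s\<close> becomes
  that of (s + g)^(p-1), hence of s^(p-1), which is -1 whatever the constant \<open>g\<close>.
  Summing over \<open>a\<close> and \<open>b\<close> gives -p^2.\<close>

lemma hesse_sum_6_cong_0:
  assumes p: "prime p" "p > 3" "p mod 3 = 2"
  shows "[hesse_sum p 6 = 0] (mod int p)"
proof -
  let ?F = "{0..<int p}"
  have *: "[(\<Sum>s\<in>?F. (s ^ 3 + g) ^ (p - 1)) = -1] (mod int p)" for g :: int
  proof -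
    have "[(\<Sum>s\<in>?F. (s ^ 3 + g) ^ (p - 1)) = (\<Sum>s\<in>?F. (s + g) ^ (p - 1))] (mod int p)"
      by (rule cong_sum_cube[OF p(1,3), where f = "\<lambda>s. (s + g) ^ (p - 1)"])
        (intro cong_pow cong_add cong_refl)
    moreover have "[(\<Sum>s\<in>?F. (1 * s + g) ^ (p - 1)) = (\<Sum>s\<in>?F. s ^ (p - 1))] (mod int p)"
      by (rule cong_sum_affine[where f = "\<lambda>s. s ^ (p - 1)"]) (use p in \<open>auto intro: cong_pow\<close>)
    moreover have "[(\<Sum>s\<in>?F. s ^ (p - 1)) = -1] (mod int p)"
      using cong_sum_power_residues[OF p(1), of "p - 1"] p(2) by simp
    ultimately show ?thesis
      unfolding mult_1 using cong_trans by blast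
  qed
  have "[hesse_sum p 6 = (\<Sum>a\<in>?F. \<Sum>b\<in>?F. -1)] (mod int p)"
    using hesse_sum_6_cong[OF p(1,2)] by (rule cong_trans) (intro cong_sum *)
  also have "(\<Sum>a\<in>?F. \<Sum>b\<in>?F. -1) = - int p * int p"
    by simp
  also have "[\<dots> = 0] (mod int p)"
    by (simp add: cong_0_iff)
  finally show ?thesis .
qed

lemma cube_root_of_unity_exists:
  assumes p: "prime p" "p mod 3 = 1"
  obtains w where "int p dvd w\<^sup>2 + w + 1"
proof -
  have "3 dvd p - 1"
    using p by presburger
  then obtain w where w: "[w ^ 3 = 1] (mod int p)"
    "\<And>i. 0 < i \<Longrightarrow> i < 3 \<Longrightarrow> \<not> [w ^ i = 1] (mod int p)"
    by (rule prime_root_of_unity_exists[OF p(1), of 3, rotated]) simp_all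
  have "(w - 1) * (w\<^sup>2 + w + 1) = w ^ 3 - 1"
    by (simp add: power2_eq_square power3_eq_cube algebra_simps)
  then have "int p dvd (w - 1) * (w\<^sup>2 + w + 1)"
    using w(1) by (simp add: cong_iff_dvd_diff)
  then have "int p dvd w\<^sup>2 + w + 1"
    using w(2)[of 1] p(1) by (simp add: cong_iff_dvd_diff prime_dvd_mult_iff)
  then show ?thesis
    by (rule that)
qed

text \<open>2w + 1 is a square root of -3 modulo \<open>p\<close>. It occurs as the determinant of
  the diagonalising substitution, up to sign, and as the witness that -3 is a square.\<close>

lemma cube_root_of_unity_discriminant:
  assumes p: "prime p" "p > 3" and w: "int p dvd w\<^sup>2 + w + 1"
  shows "\<not> int p dvd 2 * w + 1"
proof
  assume "int p dvd 2 * w + 1"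
  then have "int p dvd 4 * (w\<^sup>2 + w + 1) - (2 * w + 1) * (2 * w + 1)"
    by (intro dvd_diff dvd_mult[OF w] dvd_mult)
  also have "4 * (w\<^sup>2 + w + 1) - (2 * w + 1) * (2 * w + 1) = 3"
    by (simp add: power2_eq_square algebra_simps)
  finally show False
    using p zdvd_imp_le[of "int p" 3] by auto
qed

lemma hesse_sum_6_cong_hesse_sum_0:
  assumes p: "prime p" "p > 3" "p mod 3 = 1"
  shows "[hesse_sum p 6 = hesse_sum p 0] (mod int p)"
proof -
  let ?F = "{0..<int p}"
  obtain w where w: "int p dvd w\<^sup>2 + w + 1"
    using cube_root_of_unity_exists p by blast
  \<comment> \<open>The determinant of (a, b) -> (a + wb, a - (1 + w)b), where -(1 + w) stands for
    w^2.\<close>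
  have 12: "\<not> int p dvd - (1 + 2 * w)"
    using cube_root_of_unity_discriminant[OF p(1,2) w] by (simp add: add.commute dvd_minus_iff del: minus_add_distrib)
  define h where "h = (\<lambda>x y :: int. \<Sum>s\<in>?F. (s ^ 3 + (x ^ 3 + y ^ 3)) ^ (p - 1))"
  have hcong: "[h x y = h x' y'] (mod int p)"
    if "[x = x'] (mod int p)" "[y = y'] (mod int p)" for x y x' y'
    unfolding h_def using that by (intro cong_sum cong_pow cong_add cong_refl)
  have 1: "[hesse_sum p 6 = (\<Sum>a\<in>?F. \<Sum>b\<in>?F. h (a + w * b) (a + - (1 + w) * b))] (mod int p)"
    using hesse_sum_6_cong[OF p(1,2)]
  proof (rule cong_trans)
    have "[2 * a ^ 3 - 3 * a ^ 2 * b - 3 * a * b ^ 2 + 2 * b ^ 3 =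
        (a + w * b) ^ 3 + (a + - (1 + w) * b) ^ 3] (mod int p)" for a b
    proof -
      have "2 * a ^ 3 - 3 * a ^ 2 * b - 3 * a * b ^ 2 + 2 * b ^ 3 -
          ((a + w * b) ^ 3 + (a + - (1 + w) * b) ^ 3) =
          (w ^ 2 + w + 1) * (3 * b ^ 3 - 6 * a * b ^ 2)"
        by (simp add: power2_eq_square power3_eq_cube algebra_simps)
      then show ?thesis
        using w by (simp add: cong_iff_dvd_diff)
    qed
    then show "[(\<Sum>a\<in>?F. \<Sum>b\<in>?F. \<Sum>s\<in>?F.
        (s ^ 3 + (2 * a ^ 3 - 3 * a ^ 2 * b - 3 * a * b ^ 2 + 2 * b ^ 3)) ^ (p - 1)) =
        (\<Sum>a\<in>?F. \<Sum>b\<in>?F. h (a + w * b) (a + - (1 + w) * b))] (mod int p)"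
      unfolding h_def by (intro cong_sum cong_pow cong_add[OF cong_refl])
  qed
  \<comment> \<open>The substitution is done one variable at a time: with \<open>b\<close> fixed,
    \<open>a\<close> becomes x = a + wb; then, with \<open>x\<close> fixed, \<open>b\<close> becomes
    y = x - (1 + 2w)b.\<close>
  have 2: "(\<Sum>a\<in>?F. \<Sum>b\<in>?F. h (a + w * b) (a + - (1 + w) * b)) =
      (\<Sum>b\<in>?F. \<Sum>a\<in>?F. h (1 * a + w * b) (- (1 + 2 * w) * b + (1 * a + w * b)))"
    by (subst sum.swap) (simp add: algebra_simps)
  have 3: "[(\<Sum>b\<in>?F. \<Sum>a\<in>?F. h (1 * a + w * b) (- (1 + 2 * w) * b + (1 * a + w * b))) =
      (\<Sum>b\<in>?F. \<Sum>x\<in>?F. h x (- (1 + 2 * w) * b + x))] (mod int p)"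
  proof (rule cong_sum)
    fix b
    show "[(\<Sum>a\<in>?F. h (1 * a + w * b) (- (1 + 2 * w) * b + (1 * a + w * b))) =
        (\<Sum>x\<in>?F. h x (- (1 + 2 * w) * b + x))] (mod int p)"
      by (rule cong_sum_affine[where f = "\<lambda>x. h x (- (1 + 2 * w) * b + x)"])
        (use p in \<open>auto intro!: hcong cong_add\<close>)
  qed
  have 4: "(\<Sum>b\<in>?F. \<Sum>x\<in>?F. h x (- (1 + 2 * w) * b + x)) =
      (\<Sum>x\<in>?F. \<Sum>b\<in>?F. h x (- (1 + 2 * w) * b + x))"
    by (rule sum.swap)
  have 5: "[(\<Sum>x\<in>?F. \<Sum>b\<in>?F. h x (- (1 + 2 * w) * b + x)) = (\<Sum>x\<in>?F. \<Sum>y\<in>?F. h x y)] (mod int p)"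
    by (rule cong_sum, rule cong_sum_affine[OF p(1) 12]) (intro hcong cong_refl)
  have 6: "(\<Sum>x\<in>?F. \<Sum>y\<in>?F. h x y) = hesse_sum p 0"
    by (simp add: h_def hesse_sum_def add_ac)
  show ?thesis
    using cong_trans[OF 1[unfolded 2] cong_trans[OF 3[unfolded 4] 5[unfolded 6]]] .
qed

text \<open>At \<open>c = 0\<close> only the term with p - 1 - 3k = 0 remains, through 0^0 = 1; it
  occurs only if 3 divides p - 1.\<close>

lemma hesse_sum_0_cong:
  assumes p: "prime p" "p > 3"
  shows "[hesse_sum p 0 = (if p mod 3 = 1 then - trinomial_coeff (p div 3) else 0)] (mod int p)"
proof -
  have "(\<Sum>k\<le>(p - 1) div 3. trinomial_coeff k * int ((p - 1) choose (3 * k)) * 0 ^ (p - 1 - 3 * k)) =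
      (\<Sum>k\<le>(p - 1) div 3. if k = p div 3 then (if p mod 3 = 1 then trinomial_coeff (p div 3) else 0) else 0)"
  proof (rule sum.cong[OF refl])
    fix k assume k: "k \<in> {..(p - 1) div 3}"
    show "trinomial_coeff k * int ((p - 1) choose (3 * k)) * 0 ^ (p - 1 - 3 * k) =
        (if k = p div 3 then (if p mod 3 = 1 then trinomial_coeff (p div 3) else 0) else 0)"
    proof (cases "k = p div 3 \<and> p mod 3 = 1")
      case True
      then have "3 * k = p - 1"
        by presburger
      then show ?thesis
        using True by simp
    next
      case False
      have "3 * k \<le> p - 1"
        using k by simp
      moreover have "3 * k \<noteq> p - 1"
      proof
        assume "3 * k = p - 1"
        then have "p = 3 * k + 1"
          using p(2) by simp
        then show False
          using False by simp
      qed
      ultimately have "p - 1 - 3 * k > 0"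
        by simp
      then show ?thesis
        using False by (auto simp: power_0_left)
    qed
  qed
  also have "\<dots> = (if p mod 3 = 1 then trinomial_coeff (p div 3) else 0)"
  proof (cases "p mod 3 = 1")
    case True
    then have "p div 3 \<le> (p - 1) div 3"
      by presburger
    then show ?thesis
      using True by (simp add: sum.delta)
  qed simp
  finally show ?thesis
    using hesse_sum_cong[OF p(1), of 0] by (simp split: if_splits)
qed

text \<open>Modulo \<open>p\<close>, r^(3k) = (-1)^(3k) 6^(p-1-3k) by Fermat, and (-1)^(3k) is
  C(p-1,3k). So the left side is minus \<open>hesse_sum p 6\<close>, and replacing the parameter 6
  by 0 leaves at most one term.\<close>

lemma sum_trinomial_coeff_cong:
  assumes p: "prime p" "p > 3" and r: "[-6 * r = 1] (mod int p)"
  shows "[(\<Sum>k\<le>p div 3. trinomial_coeff k * r ^ (3 * k)) = (if p mod 3 = 1 then trinomial_coeff (p div 3) else 0)] (mod int p)"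
proof -
  have 6: "\<not> int p dvd 6"
  proof
    assume "int p dvd 6"
    then have "int p dvd 2 * 3"
      by simp
    then have "int p dvd 2 \<or> int p dvd 3"
      using p(1) by (simp only: prime_dvd_mult_iff prime_nat_int_transfer)
    then show False
      using p(2) zdvd_imp_le[of "int p" 3] zdvd_imp_le[of "int p" 2] by auto
  qed
  have *: "[trinomial_coeff k * r ^ (3 * k) = trinomial_coeff k * int ((p - 1) choose (3 * k)) * 6 ^ (p - 1 - 3 * k)] (mod int p)"
    if "3 * k \<le> p - 1" for k
  proof -
    have "[1 * r ^ (3 * k) = 6 ^ (p - 1) * r ^ (3 * k)] (mod int p)"
      by (rule cong_scalar_right, rule cong_sym, rule fermat_int[OF p(1) 6])
    also have "6 ^ (p - 1) * r ^ (3 * k) = (-1 * (-6 * r)) ^ (3 * k) * 6 ^ (p - 1 - 3 * k)"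
    proof -
      have "(6::int) ^ (p - 1) = 6 ^ (3 * k) * 6 ^ (p - 1 - 3 * k)"
        using that by (simp flip: power_add)
      then show ?thesis
        by (simp add: power_mult_distrib)
    qed
    also have "[\<dots> = (-1 * 1) ^ (3 * k) * 6 ^ (p - 1 - 3 * k)] (mod int p)"
      by (intro cong_scalar_right cong_pow cong_scalar_left r)
    also have "(-1 * 1) ^ (3 * k) * 6 ^ (p - 1 - 3 * k) = (-1) ^ (3 * k) * (6::int) ^ (p - 1 - 3 * k)"
      by simp
    also have "[\<dots> = int ((p - 1) choose (3 * k)) * 6 ^ (p - 1 - 3 * k)] (mod int p)"
      using that p by (intro cong_scalar_right cong_sym[OF choose_prime_minus_1_cong]) auto
    finally have "[trinomial_coeff k * (1 * r ^ (3 * k)) =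
        trinomial_coeff k * (int ((p - 1) choose (3 * k)) * 6 ^ (p - 1 - 3 * k))] (mod int p)"
      by (rule cong_scalar_left)
    then show ?thesis
      by (simp only: mult_1 mult.assoc)
  qed
  have "p div 3 = (p - 1) div 3"
    using prime_gt_3_mod_3[OF p] by presburger
  then have 1: "[(\<Sum>k\<le>p div 3. trinomial_coeff k * r ^ (3 * k)) =
      (\<Sum>k\<le>(p - 1) div 3. trinomial_coeff k * int ((p - 1) choose (3 * k)) * 6 ^ (p - 1 - 3 * k))] (mod int p)"
    by (simp only:) (rule cong_sum, rule *, unfold atMost_iff, presburger)
  have 2: "[- hesse_sum p 6 =
      - (- (\<Sum>k\<le>(p - 1) div 3. trinomial_coeff k * int ((p - 1) choose (3 * k)) * 6 ^ (p - 1 - 3 * k)))] (mod int p)"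
    using hesse_sum_cong[OF p(1)] by (intro cong_uminus)
  have 3: "[- hesse_sum p 6 = - (if p mod 3 = 1 then - trinomial_coeff (p div 3) else 0)] (mod int p)"
  proof (cases "p mod 3 = 1")
    case True
    then show ?thesis
      using cong_trans[OF hesse_sum_6_cong_hesse_sum_0[OF p True] hesse_sum_0_cong[OF p]]
      by (intro cong_uminus)
  next
    case False
    then have "p mod 3 = 2"
      using prime_gt_3_mod_3[OF p] by blast
    then show ?thesis
      using cong_uminus[OF hesse_sum_6_cong_0[OF p]] False by simp
  qed
  have 4: "- (if p mod 3 = 1 then - trinomial_coeff (p div 3) else 0) = (if p mod 3 = 1 then trinomial_coeff (p div 3) else 0)"
    by simp
  show ?thesis
    using cong_trans[OF 1 cong_trans[OF cong_sym[OF 2[unfolded minus_minus]] 3[unfolded 4]]] .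
qed

subsection \<open>The cubic Jacobi sum\<close>

text \<open>
  With \<open>J c = (\<Sum>x. \<chi> x * \<chi> (c - x))\<close>, the second moment \<open>\<Sum>c. \<bar>J c\<bar>\<^sup>2\<close> is evaluated twice:
  \<open>\<bar>J c\<bar> = \<bar>J 1\<bar>\<close> for \<open>c \<noteq> 0\<close>, and the correlations \<open>R d = (\<Sum>c. \<chi> c * cnj (\<chi> (c + d)))\<close>
  are \<open>-1\<close> for \<open>d \<noteq> 0\<close>.
\<close>
lemma jacobi_sum_norm:
  fixes \<chi> :: "int \<Rightarrow> complex"
  assumes p: "prime p"
    and per: "\<And>x. \<chi> (x mod int p) = \<chi> x"
    and mult: "\<And>x y. \<chi> (x * y) = \<chi> x * \<chi> y"
    and zero: "\<chi> 0 = 0"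
    and unit: "\<And>x. \<not> int p dvd x \<Longrightarrow> \<chi> x * cnj (\<chi> x) = 1"
    and sum: "(\<Sum>x\<in>{0..<int p}. \<chi> x) = 0"
    and sum_sq: "(\<Sum>x\<in>{0..<int p}. \<chi> x * \<chi> x) = 0"
  defines "J \<equiv> \<lambda>c. \<Sum>x\<in>{0..<int p}. \<chi> x * \<chi> (c - x)"
  shows "J 1 * cnj (J 1) = of_nat p"
proof -
  let ?F = "{0..<int p}"
  have p1: "p > 1"
    using p by (rule prime_gt_1_nat)
  have chi_cong: "\<chi> x = \<chi> y" if "x mod int p = y mod int p" for x y
    using per[of x] per[of y] that by simp
  have unit_F: "\<not> int p dvd x" if "x \<in> ?F - {0}" for x
    using that zdvd_not_zless[of x "int p"] by auto
  have norm_sum: "(\<Sum>x\<in>?F. \<chi> x * cnj (\<chi> x)) = of_nat p - 1"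
  proof -
    have "(\<Sum>x\<in>?F. \<chi> x * cnj (\<chi> x)) = (\<Sum>x\<in>?F - {0}. 1)"
      using unit[OF unit_F] zero by (intro sum.mono_neutral_cong_right) auto
    then show ?thesis
      using p1 by (simp add: card_Diff_singleton of_nat_diff)
  qed
  have J_unit: "J c * cnj (J c) = J 1 * cnj (J 1)" if "\<not> int p dvd c" for c
  proof -
    have "J c = (\<Sum>x\<in>?F. \<chi> (c * x + 0) * \<chi> (c - (c * x + 0)))"
      unfolding J_def
      by (rule sum_affine_mod[OF p that, where f = "\<lambda>x. \<chi> x * \<chi> (c - x)", symmetric])
        (intro arg_cong2[where f = "(*)"] chi_cong; simp add: mod_simps)
    also have "\<dots> = (\<Sum>x\<in>?F. \<chi> c * \<chi> c * (\<chi> x * \<chi> (1 - x)))"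
    proof (rule sum.cong[OF refl])
      fix x
      have "c - (c * x + 0) = c * (1 - x)"
        by (simp add: algebra_simps)
      then show "\<chi> (c * x + 0) * \<chi> (c - (c * x + 0)) = \<chi> c * \<chi> c * (\<chi> x * \<chi> (1 - x))"
        by (simp add: mult)
    qed
    also have "\<dots> = \<chi> c * \<chi> c * J 1"
      by (simp add: J_def sum_distrib_left)
    finally have "J c = \<chi> c * \<chi> c * J 1" .
    then have "J c * cnj (J c) = (\<chi> c * cnj (\<chi> c)) * (\<chi> c * cnj (\<chi> c)) * (J 1 * cnj (J 1))"
      by simp
    then show ?thesis
      by (simp only: unit[OF that] mult_1)
  qed
  have J_0: "J 0 = 0"
  proof -
    have "\<chi> x * \<chi> (0 - x) = \<chi> (-1) * (\<chi> x * \<chi> x)" for x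
      using mult[of "-1" x] by simp
    then have "J 0 = \<chi> (-1) * (\<Sum>x\<in>?F. \<chi> x * \<chi> x)"
      by (simp only: J_def sum_distrib_left)
    then show ?thesis
      by (simp add: sum_sq)
  qed
  have moment1: "(\<Sum>c\<in>?F. J c * cnj (J c)) = (of_nat p - 1) * (J 1 * cnj (J 1))"
  proof -
    have "(\<Sum>c\<in>?F. J c * cnj (J c)) = (\<Sum>c\<in>?F - {0}. J c * cnj (J c))"
      by (intro sum.mono_neutral_right) (auto simp: J_0)
    also have "\<dots> = (\<Sum>c\<in>?F - {0}. J 1 * cnj (J 1))"
      by (rule sum.cong[OF refl J_unit[OF unit_F]])
    finally show ?thesis
      using p1 by (simp add: card_Diff_singleton of_nat_diff)
  qed
  define R where "R = (\<lambda>d. \<Sum>c\<in>?F. \<chi> c * cnj (\<chi> (c + d)))"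
  have R_0: "R d = of_nat p - 1" if "int p dvd d" for d
  proof -
    have "\<chi> (c + d) = \<chi> c" for c
      using that by (intro chi_cong) (metis add.right_neutral dvd_imp_mod_0 mod_add_right_eq)
    then show ?thesis
      by (simp add: R_def norm_sum)
  qed
  have R_unit: "R d = R 1" if "\<not> int p dvd d" for d
  proof -
    have "R d = (\<Sum>c\<in>?F. \<chi> (d * c + 0) * cnj (\<chi> (d * c + 0 + d)))"
      unfolding R_def
      by (rule sum_affine_mod[OF p that, where f = "\<lambda>c. \<chi> c * cnj (\<chi> (c + d))", symmetric])
        (intro arg_cong2[where f = "(*)"] arg_cong[where f = cnj] chi_cong; simp add: mod_simps)
    also have "\<dots> = (\<Sum>c\<in>?F. (\<chi> d * cnj (\<chi> d)) * (\<chi> c * cnj (\<chi> (c + 1))))"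
    proof (rule sum.cong[OF refl])
      fix c
      have "d * c + 0 + d = d * (c + 1)"
        by (simp add: algebra_simps)
      then show "\<chi> (d * c + 0) * cnj (\<chi> (d * c + 0 + d)) =
          (\<chi> d * cnj (\<chi> d)) * (\<chi> c * cnj (\<chi> (c + 1)))"
        by (simp add: mult)
    qed
    also have "\<dots> = R 1"
      by (simp only: unit[OF that] mult_1 R_def)
    finally show ?thesis .
  qed
  have shift: "(\<Sum>x\<in>?F. f (x + e)) = (\<Sum>x\<in>?F. f x)"
    if "\<And>x. f (x mod int p) = f x" for e and f :: "int \<Rightarrow> complex"
    using sum_affine_mod[of p 1 f e] p p1 that by simp
  \<comment> \<open>Summed over \<open>d\<close>, each \<open>c\<close> meets the full character
    sum, which is 0. Since \<open>R\<close> is p - 1 at 0 and constant elsewhere, \<open>R 1\<close>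
    must be -1.\<close>
  have "(\<Sum>d\<in>?F. R d) = (\<Sum>c\<in>?F. \<chi> c * cnj (\<Sum>d\<in>?F. \<chi> (d + c)))"
    unfolding R_def by (subst sum.swap) (simp add: sum_distrib_left add.commute)
  also have "\<dots> = 0"
    using shift[of \<chi>, OF per] by (simp add: sum)
  finally have R_sum: "(\<Sum>d\<in>?F. R d) = 0" .
  have "(\<Sum>d\<in>?F. R d) = R 0 + (\<Sum>d\<in>?F - {0}. R d)"
    using p1 by (intro sum.remove) auto
  also have "(\<Sum>d\<in>?F - {0}. R d) = (\<Sum>d\<in>?F - {0}. R 1)"
    by (rule sum.cong[OF refl R_unit[OF unit_F]])
  also have "(\<Sum>d\<in>?F - {0}. R 1) = (of_nat p - 1) * R 1"
    using p1 by (simp add: card_Diff_singleton of_nat_diff)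
  also have "R 0 + (of_nat p - 1) * R 1 = (of_nat p - 1) * (1 + R 1)"
    by (simp only: R_0[OF dvd_0_right] distrib_left mult_1_right)
  finally have "(of_nat p - 1) * (1 + R 1) = 0"
    unfolding R_sum by (rule sym)
  moreover have p_neq: "of_nat p - 1 \<noteq> (0 :: complex)"
    using p1 of_nat_eq_1_iff[where ?'a = complex, of p] by auto
  ultimately have R_1: "R 1 = -1"
    by (simp add: add_eq_0_iff2 minus_equation_iff)
  have R: "R (x - y) = (if x = y then of_nat p else 0) - 1" if "x \<in> ?F" "y \<in> ?F" for x y
  proof (cases "x = y")
    case False
    then have "\<not> int p dvd x - y"
      using that cong_less_imp_eq_int[of x "int p" y] by (auto simp: cong_iff_dvd_diff)
    then show ?thesis
      using False R_unit R_1 by simp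
  qed (simp add: R_0)
  \<comment> \<open>Second evaluation of the moment: after expanding the square, the sum over
    \<open>c\<close> is R (x - y). Its part -1 contributes minus the squared modulus of the sum of
    \<open>\<chi>\<close>, which is 0; the diagonal contributes p(p-1).\<close>
  have "(\<Sum>c\<in>?F. J c * cnj (J c)) =
      (\<Sum>c\<in>?F. \<Sum>x\<in>?F. \<Sum>y\<in>?F. \<chi> x * cnj (\<chi> y) * (\<chi> (c - x) * cnj (\<chi> (c - y))))"
    by (simp add: J_def sum_product mult_ac)
  also have "\<dots> = (\<Sum>x\<in>?F. \<Sum>y\<in>?F. \<Sum>c\<in>?F. \<chi> x * cnj (\<chi> y) * (\<chi> (c - x) * cnj (\<chi> (c - y))))"
    by (rule sum_swap2[symmetric])
  also have "\<dots> = (\<Sum>x\<in>?F. \<Sum>y\<in>?F. \<chi> x * cnj (\<chi> y) * R (x - y))"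
  proof (intro sum.cong refl)
    fix x y
    have "(\<Sum>c\<in>?F. \<chi> (c - x) * cnj (\<chi> (c - y))) =
        (\<Sum>c\<in>?F. \<chi> (c + x - x) * cnj (\<chi> (c + x - y)))"
      by (rule shift[where f = "\<lambda>c. \<chi> (c - x) * cnj (\<chi> (c - y))", symmetric])
        (intro arg_cong2[where f = "(*)"] arg_cong[where f = cnj] chi_cong; simp add: mod_simps)
    also have "\<dots> = R (x - y)"
      by (simp add: R_def algebra_simps)
    finally show "(\<Sum>c\<in>?F. \<chi> x * cnj (\<chi> y) * (\<chi> (c - x) * cnj (\<chi> (c - y)))) =
        \<chi> x * cnj (\<chi> y) * R (x - y)"
      by (simp flip: sum_distrib_left)
  qed
  also have "\<dots> = (\<Sum>x\<in>?F. \<Sum>y\<in>?F.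
      (if x = y then of_nat p * (\<chi> x * cnj (\<chi> y)) else 0) - \<chi> x * cnj (\<chi> y))"
    by (intro sum.cong refl) (simp add: R algebra_simps)
  also have "\<dots> = of_nat p * (\<Sum>x\<in>?F. \<chi> x * cnj (\<chi> x)) - (\<Sum>x\<in>?F. \<chi> x) * cnj (\<Sum>x\<in>?F. \<chi> x)"
  proof -
    have "(\<Sum>x\<in>?F. \<chi> x) * cnj (\<Sum>x\<in>?F. \<chi> x) = (\<Sum>x\<in>?F. \<Sum>y\<in>?F. \<chi> x * cnj (\<chi> y))"
      by (simp only: cnj_sum sum_product)
    then show ?thesis
      by (simp only: sum_subtractf) (simp add: sum_distrib_left)
  qed
  also have "\<dots> = (of_nat p - 1) * of_nat p"
    by (simp add: norm_sum sum)
  finally show ?thesis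
    using moment1 p_neq by simp
qed

text \<open>For m = n or m = 2n the exponents m + j stay below 2(p-1) = 6n, so only x^(p-1) = x^(3n)
  can contribute. It does not occur for m = n; for m = 2n it occurs at j = n, with sign (-1)^n = 1
  because \<open>n\<close> is even.\<close>

lemma cong_sum_jacobi_power:
  assumes p: "prime p" "p = 3 * n + 1" and n: "n > 0"
  shows "[(\<Sum>x\<in>{0..<int p}. (x * (1 - x)) ^ n) = 0] (mod int p)"
    and "[(\<Sum>x\<in>{0..<int p}. (x * (1 - x)) ^ (2 * n)) = - int ((2 * n) choose n)] (mod int p)"
proof -
  have expand: "[(\<Sum>x\<in>{0..<int p}. (x * (1 - x)) ^ m) =
      (\<Sum>j\<le>m. (-1) ^ j * int (m choose j) * (if p - 1 dvd m + j then -1 else 0))] (mod int p)"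
    if "m > 0" for m
  proof -
    have "(x * (1 - x)) ^ m = (\<Sum>j\<le>m. (-1) ^ j * int (m choose j) * x ^ (m + j))" for x :: int
    proof -
      have "(1 - x) ^ m = (\<Sum>j\<le>m. int (m choose j) * (- x) ^ j)"
        using binomial_ring[of "- x" 1 m] by simp
      then show ?thesis
        by (simp add: power_mult_distrib power_add sum_distrib_left power_minus[of x] mult_ac)
    qed
    then have "(\<Sum>x\<in>{0..<int p}. (x * (1 - x)) ^ m) =
        (\<Sum>j\<le>m. (-1) ^ j * int (m choose j) * (\<Sum>x\<in>{0..<int p}. x ^ (m + j)))"
      by (simp only: sum_distrib_left) (rule sum.swap)
    moreover have "[(\<Sum>x\<in>{0..<int p}. x ^ (m + j)) = (if p - 1 dvd m + j then -1 else 0)] (mod int p)" for j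
      using cong_sum_power_residues[OF p(1), of "m + j"] that by simp
    ultimately show ?thesis
      by (simp only:) (intro cong_sum cong_scalar_left)
  qed
  have "p - 1 dvd m + j \<longleftrightarrow> m + j = 3 * n" if "m \<le> 2 * n" "j \<le> m" "m > 0" for m j
  proof
    assume "p - 1 dvd m + j"
    then obtain k where k: "m + j = 3 * n * k"
      using p(2) by auto
    have "k \<noteq> 0"
      using k that by (intro notI) simp
    moreover have "k < 2"
    proof (rule ccontr)
      assume "\<not> k < 2"
      then have "3 * n * 2 \<le> 3 * n * k"
        by (intro mult_le_mono2) simp
      then show False
        using k that n by linarith
    qed
    ultimately have "k = 1"
      by simp
    then show "m + j = 3 * n"
      using k by simp
  qed (use p(2) in auto)
  note dvd_iff = this
  have "(\<Sum>j\<le>n. (-1) ^ j * int (n choose j) * (if p - 1 dvd n + j then -1 else 0)) = 0"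
    using n by (intro sum.neutral) (auto simp: dvd_iff simp del: One_nat_def)
  then show "[(\<Sum>x\<in>{0..<int p}. (x * (1 - x)) ^ n) = 0] (mod int p)"
    using expand[OF n] by simp
  have "even n"
  proof (rule ccontr)
    assume "odd n"
    then have "even p" "p > 2"
      using p(2) n by auto
    then show False
      using prime_odd_nat[OF p(1)] by blast
  qed
  have "(\<Sum>j\<le>2 * n. (-1) ^ j * int ((2 * n) choose j) * (if p - 1 dvd 2 * n + j then -1 else 0)) =
      (\<Sum>j\<le>2 * n. if j = n then - int ((2 * n) choose n) else 0)"
    using n \<open>even n\<close> by (intro sum.cong refl) (auto simp: dvd_iff simp del: One_nat_def)
  also have "\<dots> = - int ((2 * n) choose n)"
    by simp
  finally show "[(\<Sum>x\<in>{0..<int p}. (x * (1 - x)) ^ (2 * n)) = - int ((2 * n) choose n)] (mod int p)"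
    using expand[of "2 * n"] n by simp
qed

text \<open>
  \<open>L = 2 a - b\<close> and \<open>M = b / 3\<close> for the Jacobi sum \<open>J = a + b \<omega>\<close> of the cubic character that
  sends \<open>x\<close> to \<open>\<omega> ^ k\<close> when \<open>x ^ n = w ^ k\<close> modulo \<open>p\<close>; \<open>\<alpha> + \<beta> \<omega>\<close> are its values. Reducing
  \<open>\<omega>\<close> to either cube root of unity modulo \<open>p\<close> turns \<open>J\<close> into a power sum.
\<close>
lemma cubic_jacobi_sum:
  assumes p: "prime p" "p = 3 * n + 1" "p > 3"
  obtains L M :: int where "4 * int p = L\<^sup>2 + 27 * M\<^sup>2" "[L = 1] (mod 3)"
    "[int ((2 * n) choose n) = - L] (mod int p)"
proof -
  let ?F = "{0..<int p}"
  have n: "n > 0" and pn: "p - 1 = n * 3"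
    using p by auto
  have p3: "\<not> int p dvd 3"
    using p zdvd_imp_le[of "int p" 3] by auto
  have p1: "\<not> int p dvd 1"
    using p by auto
  obtain g :: int where "[g ^ (p - 1) = 1] (mod int p)"
    "\<And>i. 0 < i \<Longrightarrow> i < p - 1 \<Longrightarrow> \<not> [g ^ i = 1] (mod int p)"
    by (rule prime_root_of_unity_exists[OF p(1), of "p - 1"]) (use p in auto)
  then have g: "[(g ^ n) ^ 3 = 1] (mod int p)" "\<not> [g ^ n = 1] (mod int p)"
    using n unfolding pn power_mult[symmetric] by simp_all
  \<comment> \<open>A primitive cube root of unity modulo \<open>p\<close>, chosen as the n-th power
    of a primitive root so that the character takes the value \<open>\<omega>\<close> at
    \<open>g\<close>.\<close>
  define w where "w = g ^ n"
  have w3: "[w ^ 3 = 1] (mod int p)"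
    using g w_def by simp
  have "(w - 1) * (w\<^sup>2 + w + 1) = w ^ 3 - 1"
    by (simp add: power2_eq_square power3_eq_cube algebra_simps)
  then have "int p dvd (w - 1) * (w\<^sup>2 + w + 1)"
    using w3 by (simp add: cong_iff_dvd_diff)
  then have w: "int p dvd w\<^sup>2 + w + 1"
    using g p(1) by (auto simp: cong_iff_dvd_diff prime_dvd_mult_iff w_def)
  have w2: "[w\<^sup>2 = -1 - w] (mod int p)"
    using w by (simp add: cong_iff_dvd_diff algebra_simps)
  have w2': "[(-1 - w)\<^sup>2 = w] (mod int p)"
    using w by (simp add: cong_iff_dvd_diff power2_eq_square algebra_simps)
  have w_neq: "\<not> int p dvd w - 1" "\<not> int p dvd w + 2" "\<not> int p dvd 2 * w + 1"
    "\<not> int p dvd w" "\<not> int p dvd w + 1"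
  proof -
    have eq: "3 = (w\<^sup>2 + w + 1) - (w - 1) * (w + 2)"
      "1 = (w\<^sup>2 + w + 1) - w * (w + 1)"
      by (simp_all add: power2_eq_square algebra_simps)
    show "\<not> int p dvd w - 1" "\<not> int p dvd w + 2"
      using p3 dvd_diff[OF w dvd_mult2] dvd_diff[OF w dvd_mult] unfolding eq(1) by blast+
    show "\<not> int p dvd 2 * w + 1"
      by (rule cube_root_of_unity_discriminant[OF p(1,3) w])
    show "\<not> int p dvd w" "\<not> int p dvd w + 1"
      using p1 dvd_diff[OF w dvd_mult2, of w "w + 1"] dvd_diff[OF w dvd_mult, of "w + 1" w]
      unfolding eq(2)[symmetric] by blast+
  qed
  define \<alpha> where "\<alpha> = (\<lambda>x::int. if [x ^ n = 1] (mod int p) then 1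
    else if [x ^ n = -1 - w] (mod int p) then -1 else 0 :: int)"
  define \<beta> where "\<beta> = (\<lambda>x::int. if [x ^ n = w] (mod int p) then 1
    else if [x ^ n = -1 - w] (mod int p) then -1 else 0 :: int)"
  \<comment> \<open>0 and the three cube roots of unity are pairwise incongruent, so the case
    distinctions above are unambiguous and give 0 at multiples of \<open>p\<close>.\<close>
  have distinct: "\<not> [1 = w] (mod int p)" "\<not> [1 = -1 - w] (mod int p)" "\<not> [w = -1 - w] (mod int p)"
    "\<not> [0 = 1] (mod int p)" "\<not> [0 = w] (mod int p)" "\<not> [0 = -1 - w] (mod int p)"
  proof -
    have *: "[x = y] (mod int p) \<longleftrightarrow> int p dvd y - x" for x y
      by (metis cong_iff_dvd_diff cong_sym_eq)
    have "-1 - w - 1 = - (w + 2)" "-1 - w - w = - (2 * w + 1)" "-1 - w - 0 = - (w + 1)"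
      by simp_all
    then show "\<not> [1 = w] (mod int p)" "\<not> [1 = -1 - w] (mod int p)" "\<not> [w = -1 - w] (mod int p)"
      "\<not> [0 = 1] (mod int p)" "\<not> [0 = w] (mod int p)" "\<not> [0 = -1 - w] (mod int p)"
      using w_neq p1 unfolding * by (simp_all only: dvd_minus_iff diff_0_right not_False_eq_True)
  qed
  have value0: "\<alpha> x = 1 \<and> \<beta> x = 0" if "[x ^ n = 1] (mod int p)" for x
    using that distinct cong_trans[OF cong_sym[OF that]] unfolding \<alpha>_def \<beta>_def by auto
  have value1: "\<alpha> x = 0 \<and> \<beta> x = 1" if "[x ^ n = w] (mod int p)" for x
    using that distinct cong_trans[OF cong_sym[OF that]] cong_sym unfolding \<alpha>_def \<beta>_def by auto
  have value2: "\<alpha> x = -1 \<and> \<beta> x = -1" if "[x ^ n = -1 - w] (mod int p)" for x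
    using that distinct cong_trans[OF cong_sym[OF that]] cong_sym unfolding \<alpha>_def \<beta>_def by auto
  have value_0: "\<alpha> 0 = 0" "\<beta> 0 = 0"
    using distinct n by (simp_all add: \<alpha>_def \<beta>_def power_0_left)
  have per: "\<alpha> (x mod int p) = \<alpha> x" "\<beta> (x mod int p) = \<beta> x" for x
    by (simp_all add: \<alpha>_def \<beta>_def cong_def power_mod)
  have value_dvd: "\<alpha> x = 0" "\<beta> x = 0" if "int p dvd x" for x
    using per[of x] value_0 that by simp_all
  \<comment> \<open>X^3 - 1 splits as (X - 1)(X - w)(X + 1 + w) modulo w^2 + w + 1; subtracting (X -
    1)(w^2 + w + 1) turns this into an exact identity.\<close>
  have cases: "[x ^ n = 1] (mod int p) \<or> [x ^ n = w] (mod int p) \<or> [x ^ n = -1 - w] (mod int p)"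
    if "\<not> int p dvd x" for x
  proof -
    have "[(x ^ n) ^ 3 = 1] (mod int p)"
      using fermat_int[OF p(1) that] by (simp only: pn flip: power_mult)
    then have "int p dvd (x ^ n) ^ 3 - 1 - (x ^ n - 1) * (w\<^sup>2 + w + 1)"
      using w by (simp add: cong_iff_dvd_diff)
    also have "(x ^ n) ^ 3 - 1 - (x ^ n - 1) * (w\<^sup>2 + w + 1) =
        (x ^ n - 1) * ((x ^ n - w) * (x ^ n - (-1 - w)))"
      by (simp add: power2_eq_square power3_eq_cube algebra_simps)
    finally show ?thesis
      using p(1) by (simp only: cong_iff_dvd_diff prime_dvd_mult_iff prime_nat_int_transfer)
  qed
  define \<omega> where "\<omega> = Complex (-1 / 2) (sqrt 3 / 2)"
  have \<omega>: "\<omega> * \<omega> = -1 - \<omega>" "cnj \<omega> = -1 - \<omega>" "Im \<omega> \<noteq> 0"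
    "\<omega> * (-1 - \<omega>) = 1"
    by (simp_all add: \<omega>_def complex_eq_iff)
  have \<omega>3: "\<omega> ^ 3 = 1"
  proof -
    have "\<omega> ^ 3 = \<omega> * (\<omega> * \<omega>)"
      by (simp add: power3_eq_cube)
    also have "\<dots> = \<omega> * (-1 - \<omega>)"
      by (simp only: \<omega>(1))
    also have "\<dots> = - \<omega> - \<omega> * \<omega>"
      by (simp add: algebra_simps)
    also have "\<dots> = 1"
      by (simp only: \<omega>(1)) simp
    finally show ?thesis .
  qed
  define \<chi> where "\<chi> = (\<lambda>x. of_int (\<alpha> x) + of_int (\<beta> x) * \<omega>)"
  \<comment> \<open>Modulo 3 the coefficient \<open>\<beta>\<close> of a power of
    \<open>\<omega>\<close> is the exponent \<open>k\<close>, and \<open>\<alpha>\<close> is 1 - k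
    (both are -1 for k = 2). Thus \<open>\<beta>\<close> behaves like a logarithm modulo 3, which is
    the source of the congruences for \<open>a\<close> and \<open>b\<close>.\<close>
  have power: "\<chi> x = \<omega> ^ k \<and> [\<beta> x = int k] (mod 3) \<and> [\<alpha> x = 1 - int k] (mod 3)"
    if "[x ^ n = w ^ k] (mod int p)" for x k
  proof -
    have "\<omega> ^ k = (\<omega> ^ 3) ^ (k div 3) * \<omega> ^ (k mod 3)"
      by (simp flip: power_mult power_add)
    then have \<omega>k: "\<omega> ^ k = \<omega> ^ (k mod 3)"
      by (simp add: \<omega>3)
    have "w ^ k = (w ^ 3) ^ (k div 3) * w ^ (k mod 3)"
      by (simp flip: power_mult power_add)
    also have "[(w ^ 3) ^ (k div 3) * w ^ (k mod 3) = 1 ^ (k div 3) * w ^ (k mod 3)] (mod int p)"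
      by (intro cong_mult cong_pow w3 cong_refl)
    finally have "[w ^ k = w ^ (k mod 3)] (mod int p)"
      by simp
    from cong_trans[OF that this] have wk: "[x ^ n = w ^ (k mod 3)] (mod int p)" .
    have ik: "int k = 3 * int (k div 3) + int (k mod 3)"
      by presburger
    consider "k mod 3 = 0" | "k mod 3 = 1" | "k mod 3 = 2"
      by linarith
    then show ?thesis
    proof cases
      case 1
      with wk value0[of x] show ?thesis
        unfolding \<omega>k ik by (simp add: \<chi>_def cong_iff_dvd_diff)
    next
      case 2
      with wk value1[of x] show ?thesis
        unfolding \<omega>k ik by (simp add: \<chi>_def cong_iff_dvd_diff)
    next
      case 3
      with wk value2[of x] cong_trans[OF _ w2] have "\<alpha> x = -1" "\<beta> x = -1"
        by auto
      moreover have "3 dvd -1 - (3 * int (k div 3) + 2)" "3 dvd -1 - (1 - (3 * int (k div 3) + 2))"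
        by presburger+
      ultimately show ?thesis
        using 3 unfolding \<omega>k ik by (simp add: \<chi>_def cong_iff_dvd_diff power2_eq_square \<omega>)
    qed
  qed
  have exponent: "\<exists>k. [x ^ n = w ^ k] (mod int p)" if "\<not> int p dvd x" for x
  proof -
    from cases[OF that] consider "[x ^ n = w ^ 0] (mod int p)" | "[x ^ n = w ^ 1] (mod int p)"
      | "[x ^ n = w ^ 2] (mod int p)"
      using cong_trans[OF _ cong_sym[OF w2]] by auto
    then show ?thesis
      by cases blast+
  qed
  have mult_unit: "\<chi> (x * y) = \<chi> x * \<chi> y \<and> [\<beta> (x * y) = \<beta> x + \<beta> y] (mod 3) \<and>
      [\<alpha> (x * y) = 1 - \<beta> (x * y)] (mod 3)"
    if xy: "\<not> int p dvd x" "\<not> int p dvd y" for x y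
  proof -
    obtain k l where k: "[x ^ n = w ^ k] (mod int p)" and l: "[y ^ n = w ^ l] (mod int p)"
      using exponent xy by blast
    have "[(x * y) ^ n = w ^ (k + l)] (mod int p)"
      using cong_mult[OF k l] by (simp add: power_mult_distrib power_add)
    note kl = power[OF this] power[OF k] power[OF l]
    have "[\<beta> x + \<beta> y = int (k + l)] (mod 3)"
      using cong_add[of "\<beta> x" "int k" 3 "\<beta> y" "int l"] kl by simp
    moreover have "[1 - \<beta> (x * y) = 1 - int (k + l)] (mod 3)"
      using kl by (intro cong_diff) auto
    ultimately show ?thesis
      using kl cong_trans cong_sym by (metis power_add)
  qed
  have \<chi>_dvd: "\<chi> x = 0" if "int p dvd x" for x
    using value_dvd[OF that] by (simp add: \<chi>_def)
  have mult: "\<chi> (x * y) = \<chi> x * \<chi> y" for x y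
    using mult_unit[of x y] \<chi>_dvd[of "x * y"] \<chi>_dvd[of x] \<chi>_dvd[of y]
    by (cases "int p dvd x \<or> int p dvd y") auto
  have \<chi>_per: "\<chi> (x mod int p) = \<chi> x" for x
    by (simp add: \<chi>_def per)
  have \<chi>g: "\<chi> g = \<omega>"
    using value1[of g] by (simp add: \<chi>_def w_def)
  have g_dvd: "\<not> int p dvd g"
    using \<chi>_dvd[of g] \<omega>(3) \<chi>g by auto
  have sum_0: "(\<Sum>x\<in>?F. \<chi> x) = 0"
  proof -
    have "(\<Sum>x\<in>?F. \<chi> (g * x + 0)) = (\<Sum>x\<in>?F. \<chi> x)"
      by (rule sum_affine_mod[OF p(1) g_dvd, where f = \<chi>]) (rule \<chi>_per)
    then have "(\<omega> - 1) * (\<Sum>x\<in>?F. \<chi> x) = 0"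
      by (simp add: mult \<chi>g left_diff_distrib flip: sum_distrib_left)
    then show ?thesis
      using \<omega>(3) by auto
  qed
  have sum_sq: "(\<Sum>x\<in>?F. \<chi> x * \<chi> x) = 0"
  proof -
    have "(\<Sum>x\<in>?F. \<chi> (g * x + 0) * \<chi> (g * x + 0)) = (\<Sum>x\<in>?F. \<chi> x * \<chi> x)"
      by (rule sum_affine_mod[OF p(1) g_dvd, where f = "\<lambda>x. \<chi> x * \<chi> x"]) (simp only: \<chi>_per)
    moreover have "\<chi> (g * x + 0) * \<chi> (g * x + 0) = (\<omega> * \<omega>) * (\<chi> x * \<chi> x)" for x
      by (simp add: mult \<chi>g)
    ultimately have "(\<omega> * \<omega> - 1) * (\<Sum>x\<in>?F. \<chi> x * \<chi> x) = 0"
      by (simp only: left_diff_distrib mult_1 flip: sum_distrib_left) simp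
    moreover have "\<omega> * \<omega> \<noteq> 1"
    proof
      assume "\<omega> * \<omega> = 1"
      then have "Im (-1 - \<omega>) = Im 1"
        by (simp only: \<omega>(1))
      then show False
        using \<omega>(3) by simp
    qed
    ultimately show ?thesis
      by simp
  qed
  have unit: "\<chi> x * cnj (\<chi> x) = 1" if x: "\<not> int p dvd x" for x
  proof -
    obtain k where "[x ^ n = w ^ k] (mod int p)"
      using exponent[OF x] by blast
    then have "\<chi> x * cnj (\<chi> x) = (\<omega> * cnj \<omega>) ^ k"
      using power by (simp add: power_mult_distrib)
    also have "\<omega> * cnj \<omega> = 1"
      unfolding \<omega>(2) by (rule \<omega>(4))
    finally show ?thesis
      by simp
  qed
  define a b where "a = (\<Sum>x\<in>?F. \<alpha> (x * (1 - x)))" and "b = (\<Sum>x\<in>?F. \<beta> (x * (1 - x)))"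
  have J: "(\<Sum>x\<in>?F. \<chi> x * \<chi> (1 - x)) = of_int a + of_int b * \<omega>"
    by (simp only: a_def b_def of_int_sum sum_distrib_right flip: mult sum.distrib) (simp only: \<chi>_def)
  have norm: "a\<^sup>2 - a * b + b\<^sup>2 = int p"
  proof -
    have "(of_int a + of_int b * \<omega>) * cnj (of_int a + of_int b * \<omega>) = of_nat p"
      using jacobi_sum_norm[OF p(1), of \<chi>] \<chi>_per mult \<chi>_dvd[of 0] unit sum_0 sum_sq
      unfolding J by simp
    moreover have "(of_int a + of_int b * \<omega>) * cnj (of_int a + of_int b * \<omega>) =
        of_int (a\<^sup>2 - a * b + b\<^sup>2)"
    proof -
      have "(of_int a + of_int b * \<omega>) * (of_int a + of_int b * (-1 - \<omega>)) =
          of_int a * of_int a - of_int a * of_int b - of_int b * of_int b * (\<omega> + \<omega> * \<omega>)"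
        by (simp add: algebra_simps)
      then show ?thesis
        by (simp add: \<omega> power2_eq_square)
    qed
    ultimately have "of_int (a\<^sup>2 - a * b + b\<^sup>2) = (of_int (int p) :: complex)"
      by simp
    then show ?thesis
      using of_int_eq_iff by blast
  qed
  have unit_F: "\<not> int p dvd x" "\<not> int p dvd 1 - x" if "x \<in> ?F - {0, 1}" for x
    using that zdvd_not_zless[of x "int p"] zdvd_not_zless[of "x - 1" "int p"]
    by (auto simp: dvd_diff_commute[of _ 1 x])
  have "(\<Sum>x\<in>?F. \<beta> x) = 0"
  proof -
    have "of_int (\<Sum>x\<in>?F. \<alpha> x) + of_int (\<Sum>x\<in>?F. \<beta> x) * \<omega> = 0"
      using sum_0 unfolding \<chi>_def by (simp add: sum.distrib sum_distrib_right)
    then have "Im (of_int (\<Sum>x\<in>?F. \<alpha> x) + of_int (\<Sum>x\<in>?F. \<beta> x) * \<omega>) = 0"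
      by (simp only: zero_complex.sel)
    then show ?thesis
      using \<omega>(3) by (simp del: of_int_sum)
  qed
  moreover have "(\<Sum>x\<in>?F. \<beta> (-1 * x + 1)) = (\<Sum>x\<in>?F. \<beta> x)"
    by (rule sum_affine_mod[OF p(1), where f = \<beta>]) (use p1 per(2) in simp_all)
  ultimately have sum_\<beta>: "(\<Sum>x\<in>?F. \<beta> x + \<beta> (1 - x)) = 0"
    by (simp add: sum.distrib)
  have \<beta>1: "\<beta> 1 = 0"
    using value0[of 1] by simp
  \<comment> \<open>Additivity of \<open>\<beta>\<close> modulo 3 splits \<open>b\<close> into two
    full sums of \<open>\<beta>\<close>, which are zero. At x = 0 and x = 1 the splitting holds
    because \<open>\<beta>\<close> vanishes at 0 and at 1.\<close>
  have "[b = (\<Sum>x\<in>?F. \<beta> x + \<beta> (1 - x))] (mod 3)"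
    unfolding b_def
  proof (rule cong_sum)
    fix x assume x: "x \<in> ?F"
    show "[\<beta> (x * (1 - x)) = \<beta> x + \<beta> (1 - x)] (mod 3)"
    proof (cases "x \<in> {0, 1}")
      case True
      then show ?thesis
        using \<beta>1 value_0 by auto
    next
      case False
      then show ?thesis
        using mult_unit[OF unit_F[of x]] x by blast
    qed
  qed
  then have b3: "3 dvd b"
    by (simp add: sum_\<beta> cong_0_iff)
  \<comment> \<open>Each x other than 0 and 1 contributes 1 - \<open>\<beta>\<close>, so a = p - 2 -
    b = -1 modulo 3, and hence 2a - b = 1 modulo 3.\<close>
  have "[a = (\<Sum>x\<in>?F. (if x \<in> {0, 1} then 0 else 1) - \<beta> (x * (1 - x)))] (mod 3)"
    unfolding a_def
  proof (rule cong_sum)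
    fix x assume x: "x \<in> ?F"
    show "[\<alpha> (x * (1 - x)) = (if x \<in> {0, 1} then 0 else 1) - \<beta> (x * (1 - x))] (mod 3)"
    proof (cases "x \<in> {0, 1}")
      case True
      then show ?thesis
        using value_0 by auto
    next
      case False
      then show ?thesis
        using mult_unit[OF unit_F[of x]] x by simp
    qed
  qed
  moreover have "(\<Sum>x\<in>?F. if x \<in> {0, 1} then 0 else 1) = int p - 2"
  proof -
    have "(\<Sum>x\<in>?F. if x \<in> {0, 1} then 0 else 1) = (\<Sum>x\<in>?F - {0, 1}. 1 :: int)"
      by (intro sum.mono_neutral_cong_right) auto
    also have "\<dots> = int p - 2"
      using p by (simp add: card_Diff_subset of_nat_diff)
    finally show ?thesis .
  qed
  ultimately have a3: "[a = int p - 2 - b] (mod 3)"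
    by (simp only: sum_subtractf b_def)
  have red1: "[\<alpha> x + \<beta> x * w = x ^ n] (mod int p)"
    and red2: "[\<alpha> x + \<beta> x * (-1 - w) = x ^ (2 * n)] (mod int p)" for x
  proof -
    have x2n: "x ^ (2 * n) = (x ^ n)\<^sup>2"
      by (simp add: mult.commute flip: power_mult)
    consider "int p dvd x" | "[x ^ n = 1] (mod int p)" | "[x ^ n = w] (mod int p)"
      | "[x ^ n = -1 - w] (mod int p)"
      using cases by blast
    then have "[\<alpha> x + \<beta> x * w = x ^ n] (mod int p) \<and> [\<alpha> x + \<beta> x * (-1 - w) = (x ^ n)\<^sup>2] (mod int p)"
    proof cases
      case 1
      then have "int p dvd x ^ n" "int p dvd (x ^ n)\<^sup>2"
        using n by (auto simp: dvd_power_le[of _ _ 1] intro: dvd_trans[OF _ dvd_power])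
      then show ?thesis
        using value_dvd[OF 1] by (simp add: cong_iff_dvd_diff)
    next
      case 2
      then show ?thesis
        using value0[OF 2] cong_pow[OF 2, of 2] by (simp add: cong_sym)
    next
      case 3
      then show ?thesis
        using value1[OF 3] cong_trans[OF cong_pow[OF 3, of 2] w2] by (simp add: cong_sym)
    next
      case 4
      then show ?thesis
        using value2[OF 4] cong_trans[OF cong_pow[OF 4, of 2] w2'] by (simp add: cong_sym)
    qed
    then show "[\<alpha> x + \<beta> x * w = x ^ n] (mod int p)"
      "[\<alpha> x + \<beta> x * (-1 - w) = x ^ (2 * n)] (mod int p)"
      unfolding x2n by blast+
  qed
  \<comment> \<open>The trace of the Jacobi sum: adding its two reductions cancels
    \<open>w\<close>.\<close>
  have sum: "2 * a - b = (\<Sum>x\<in>?F. \<alpha> (x * (1 - x)) + \<beta> (x * (1 - x)) * w) +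
      (\<Sum>x\<in>?F. \<alpha> (x * (1 - x)) + \<beta> (x * (1 - x)) * (-1 - w))"
    by (simp only: sum.distrib a_def b_def flip: sum_distrib_right) (simp add: algebra_simps)
  have "[2 * a - b = (\<Sum>x\<in>?F. (x * (1 - x)) ^ n) + (\<Sum>x\<in>?F. (x * (1 - x)) ^ (2 * n))] (mod int p)"
    unfolding sum by (intro cong_add cong_sum red1 red2)
  moreover have "[(\<Sum>x\<in>?F. (x * (1 - x)) ^ n) + (\<Sum>x\<in>?F. (x * (1 - x)) ^ (2 * n)) =
      0 + - int ((2 * n) choose n)] (mod int p)"
    by (intro cong_add cong_sum_jacobi_power[OF p(1,2) n])
  ultimately have "[2 * a - b = 0 + - int ((2 * n) choose n)] (mod int p)"
    by (rule cong_trans)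
  then have L: "[2 * a - b = - int ((2 * n) choose n)] (mod int p)"
    by simp
  obtain m where m: "b = 3 * m"
    using b3 by blast
  show ?thesis
  proof (rule that[of "2 * a - b" m])
    show "4 * int p = (2 * a - b)\<^sup>2 + 27 * m\<^sup>2"
      unfolding norm[symmetric] m by (simp add: power2_eq_square algebra_simps)
    show "[2 * a - b = 1] (mod 3)"
      using a3 unfolding m p(2) cong_iff_dvd_diff by presburger
    show "[int ((2 * n) choose n) = - (2 * a - b)] (mod int p)"
      using cong_uminus[OF L] cong_sym by simp
  qed
qed

text \<open>Eliminating L^2 and L'^2 shows that \<open>p\<close> divides (LM' - L'M)(LM' + L'M).
  Composing the two representations bounds the factor divisible by \<open>p\<close> so tightly that
  it is 0, and then M^2 = M'^2.\<close>

lemma sq_plus_27_sq_unique: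
  fixes L M L' M' :: int
  assumes p: "prime p" "p > 3"
    and eq: "4 * int p = L\<^sup>2 + 27 * M\<^sup>2" "4 * int p = L'\<^sup>2 + 27 * M'\<^sup>2"
  shows "L\<^sup>2 = L'\<^sup>2"
proof -
  \<comment> \<open>A nonzero multiple of \<open>p\<close> would give 27 x^2 >= 27 p^2 > 16
    p^2.\<close>
  have small: "x = 0" if dvd: "int p dvd x" and sq: "16 * (int p)\<^sup>2 = y\<^sup>2 + 27 * x\<^sup>2" for x y :: int
  proof (rule ccontr)
    assume "x \<noteq> 0"
    obtain k where k: "x = int p * k"
      using dvd by blast
    with \<open>x \<noteq> 0\<close> have "k \<noteq> 0"
      by auto
    then have "1 \<le> k\<^sup>2"
      by (simp add: int_one_le_iff_zero_less)
    then have "(int p)\<^sup>2 * 1 \<le> (int p)\<^sup>2 * k\<^sup>2"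
      by (intro mult_left_mono) auto
    moreover have "x\<^sup>2 = (int p)\<^sup>2 * k\<^sup>2"
      by (simp add: k power_mult_distrib)
    moreover have "(int p)\<^sup>2 > 0"
      using p by simp
    ultimately show False
      using sq zero_le_power2[of y] by linarith
  qed
  have "(L * M' - L' * M) * (L * M' + L' * M) = 4 * int p * (M'\<^sup>2 - M\<^sup>2)"
  proof -
    have "(L * M' - L' * M) * (L * M' + L' * M) = L\<^sup>2 * M'\<^sup>2 - L'\<^sup>2 * M\<^sup>2"
      by (simp add: power2_eq_square algebra_simps)
    also have "L\<^sup>2 = 4 * int p - 27 * M\<^sup>2" 
      using eq by simp
    also have "L'\<^sup>2 = 4 * int p - 27 * M'\<^sup>2"
      using eq by simp
    finally show ?thesis
      by (simp add: algebra_simps)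
  qed
  note prod = this
  then have "int p dvd (L * M' - L' * M) * (L * M' + L' * M)"
    by simp
  then have "int p dvd L * M' - L' * M \<or> int p dvd L * M' + L' * M"
    using p(1) by (simp add: prime_dvd_mult_iff)
  \<comment> \<open>Brahmagupta's identity for X^2 + 27 Y^2, with either choice of sign.\<close>
  moreover have "16 * (int p)\<^sup>2 = (L * L' + 27 * M * M')\<^sup>2 + 27 * (L * M' - L' * M)\<^sup>2"
    "16 * (int p)\<^sup>2 = (L * L' - 27 * M * M')\<^sup>2 + 27 * (L * M' + L' * M)\<^sup>2"
  proof -
    have "16 * (int p)\<^sup>2 = (4 * int p) * (4 * int p)"
      by (simp add: power2_eq_square)
    also have "\<dots> = (L\<^sup>2 + 27 * M\<^sup>2) * (L'\<^sup>2 + 27 * M'\<^sup>2)"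
      using eq by simp
    finally have "16 * (int p)\<^sup>2 = (L\<^sup>2 + 27 * M\<^sup>2) * (L'\<^sup>2 + 27 * M'\<^sup>2)" .
    then show "16 * (int p)\<^sup>2 = (L * L' + 27 * M * M')\<^sup>2 + 27 * (L * M' - L' * M)\<^sup>2"
      "16 * (int p)\<^sup>2 = (L * L' - 27 * M * M')\<^sup>2 + 27 * (L * M' + L' * M)\<^sup>2"
      by (simp_all add: power2_eq_square algebra_simps)
  qed
  ultimately have "L * M' - L' * M = 0 \<or> L * M' + L' * M = 0"
    using small by blast
  then have "4 * int p * (M'\<^sup>2 - M\<^sup>2) = 0"
    unfolding prod[symmetric] by auto
  then show ?thesis
    using eq p by simp
qed

subsection \<open>Factorials modulo \<open>p\<close>\<close>

text \<open>j! k! C(p-1,j) = (p-1)! is -1 by Wilson's theorem, and C(p-1,j) is (-1)^j.\<close>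

lemma fact_mult_fact_cong:
  assumes p: "prime p" and "j + k = p - 1"
  shows "[fact j * fact k = (-1) ^ Suc j] (mod int p)"
proof -
  have "j < p"
    using assms(2) prime_gt_0_nat[OF p] by simp
  have choose: "fact j * fact k * ((p - 1) choose j) = fact (p - 1)"
  proof -
    have "j \<le> p - 1" "p - 1 - j = k"
      using assms(2) by simp_all
    then show ?thesis
      using binomial_fact_lemma[of j "p - 1"] by (simp only:)
  qed
  have "[fact j * fact k * ((-1) ^ j * (-1) ^ j) = fact j * fact k * (int ((p - 1) choose j) * (-1) ^ j)] (mod int p)"
    by (intro cong_scalar_left cong_scalar_right cong_sym[OF choose_prime_minus_1_cong[OF p \<open>j < p\<close>]])
  also have "fact j * fact k * (int ((p - 1) choose j) * (-1) ^ j) = int (fact j * fact k * ((p - 1) choose j)) * (-1) ^ j"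
    by simp
  also have "\<dots> = fact (p - 1) * (-1) ^ j"
    unfolding choose by simp
  also have "[fact (p - 1) * (-1) ^ j = (-1) * (-1) ^ j] (mod int p)"
    using wilson_theorem[OF p] by (intro cong_scalar_right)
  finally show ?thesis
    by (simp flip: power_add)
qed

lemma fact_duplication:
  "(fact (2 * k) :: int) = 2 ^ k * fact k * (\<Prod>i<k. 2 * int i + 1)"
  by (induction k) (simp_all add: algebra_simps)

text \<open>Legendre duplication: the odd factors \<open>2 i + 1\<close> of \<open>fact (2 k)\<close> are \<open>2 (h + 1 + i)\<close> modulo \<open>p = 2 h + 1\<close>.\<close>
lemma fact_duplication_cong:
  assumes "p = 2 * h + 1"
  shows "[fact (2 * k) * fact h = 4 ^ k * fact k * fact (h + k)] (mod int p)"
proof -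
  have "[(\<Prod>i<k. 2 * int i + 1) = (\<Prod>i<k. 2 * (int h + 1 + int i))] (mod int p)"
  proof (rule cong_prod)
    fix i
    have "(2 * int i + 1) - 2 * (int h + 1 + int i) = - int p"
      using assms by simp
    then show "[2 * int i + 1 = 2 * (int h + 1 + int i)] (mod int p)"
      by (simp add: cong_iff_dvd_diff)
  qed
  then have "[(\<Prod>i<k. 2 * int i + 1) * fact h = (\<Prod>i<k. 2 * (int h + 1 + int i)) * fact h] (mod int p)"
    by (rule cong_scalar_right)
  also have "(\<Prod>i<k. 2 * (int h + 1 + int i)) * fact h = 2 ^ k * fact (h + k)"
  proof (induction k)
    case (Suc k)
    have "(\<Prod>i<Suc k. 2 * (int h + 1 + int i)) * fact h =
        ((\<Prod>i<k. 2 * (int h + 1 + int i)) * fact h) * (2 * (int h + 1 + int k))"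
      by (simp only: prod.lessThan_Suc mult_ac)
    also have "\<dots> = 2 ^ k * fact (h + k) * (2 * (int h + 1 + int k))"
      by (simp only: Suc.IH)
    also have "\<dots> = 2 ^ Suc k * fact (h + Suc k)"
      by (simp add: algebra_simps)
    finally show ?case .
  qed simp
  finally have "[(\<Prod>i<k. 2 * int i + 1) * fact h = 2 ^ k * fact (h + k)] (mod int p)" .
  then have "[2 ^ k * fact k * ((\<Prod>i<k. 2 * int i + 1) * fact h) = 2 ^ k * fact k * (2 ^ k * fact (h + k))] (mod int p)"
    by (intro cong_scalar_left)
  moreover have "(2::int) ^ k * 2 ^ k = 4 ^ k"
    by (simp flip: power_mult_distrib)
  ultimately show ?thesis
    unfolding fact_duplication by (simp add: mult_ac)
qed

lemma trinomial_coeff_mult_fact: "trinomial_coeff k * fact k ^ 3 = fact (3 * k)"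
proof -
  have "fact k * fact k * ((2 * k) choose k) = fact (2 * k)"
    using binomial_fact_lemma[of k "2 * k"] by simp
  moreover have "fact k * fact (2 * k) * ((3 * k) choose k) = fact (3 * k)"
    using binomial_fact_lemma[of k "3 * k"] by simp
  moreover have "((2 * k) choose k) * ((3 * k) choose k) * fact k ^ 3 =
      fact k * (fact k * fact k * ((2 * k) choose k)) * ((3 * k) choose k)"
    by (simp only: power3_eq_cube mult_ac)
  ultimately have "((2 * k) choose k) * ((3 * k) choose k) * fact k ^ 3 = fact (3 * k)"
    by (simp only:)
  then have "int (((2 * k) choose k) * ((3 * k) choose k) * fact k ^ 3) = int (fact (3 * k))"
    by (rule arg_cong)
  then show ?thesis
    by (simp add: trinomial_coeff_def)
qed

text \<open>The second factor C(3n,n) lies in row p - 1, hence is (-1)^n, and \<open>n\<close> is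
  even because \<open>p\<close> is odd.\<close>

lemma trinomial_coeff_third_cong:
  assumes p: "prime p" "p = 3 * n + 1" "p > 3"
  shows "[trinomial_coeff n = int ((2 * n) choose n)] (mod int p)"
proof -
  have "even n"
  proof (rule ccontr)
    assume "odd n"
    then show False
      using prime_odd_nat[OF p(1)] p(2,3) by auto
  qed
  then have "[int ((p - 1) choose n) = 1] (mod int p)"
    using choose_prime_minus_1_cong[OF p(1), of n] p(2) by simp
  then have "[int ((2 * n) choose n) * int ((p - 1) choose n) = int ((2 * n) choose n) * 1] (mod int p)"
    by (rule cong_scalar_left)
  then show ?thesis
    by (simp add: trinomial_coeff_def p(2))
qed

text \<open>Both sides are inverse to (2k)!^6 modulo \<open>p\<close>. For the right side this is
  (2k)!(4k)! = -1; for the left side it combines (3k)!^2 = (-1)^(k+1), the duplication formula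
  (2k)!(3k)! = 4^k k!(4k)! and t^(3k) = (-1)^k.\<close>

lemma trinomial_coeff_sixth_cong:
  assumes p: "prime p" "p = 6 * k + 1" and t: "[3 * t = 1] (mod int p)"
  shows "[trinomial_coeff k * t ^ (3 * k) = (int ((4 * k) choose (2 * k)))\<^sup>2] (mod int p)"
proof -
  define C where "C = int ((4 * k) choose (2 * k))"
  define a b c d :: int where "a = fact k" and "b = fact (2 * k)" and "c = fact (3 * k)" and "d = fact (4 * k)"
  have k: "k > 0"
    using p prime_gt_1_nat by (cases k) auto
  have coprime_fact: "\<not> int p dvd fact j" if "j < p" for j
    using that prime_dvd_fact_iff[OF p(1), of j] int_dvd_int_iff[of p "fact j"] by simp
  have bb: "b * b * C = d"
  proof -
    have "fact (2 * k) * fact (2 * k) * ((4 * k) choose (2 * k)) = fact (4 * k)"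
      using binomial_fact_lemma[of "2 * k" "4 * k"] by simp
    then have "int (fact (2 * k) * fact (2 * k) * ((4 * k) choose (2 * k))) = int (fact (4 * k))"
      by (rule arg_cong)
    then show ?thesis
      by (simp add: b_def d_def C_def)
  qed
  have bd: "[b * d = -1] (mod int p)"
    using fact_mult_fact_cong[OF p(1), of "2 * k" "4 * k"] p(2) by (simp add: b_def d_def)
  have cc: "[c * c = (-1) ^ Suc k] (mod int p)"
    using fact_mult_fact_cong[OF p(1), of "3 * k" "3 * k"] p(2) by (simp add: c_def power_mult)
  have bc: "[b * c = 4 ^ k * a * d] (mod int p)"
    using fact_duplication_cong[of p "3 * k" k] p(2) by (simp add: a_def b_def c_def d_def)
  have prime_less: "\<not> int p dvd j" if "0 < j" "j < int p" for j
    using that zdvd_not_zless by blast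
  have p_mod: "p mod 3 = 1" "p > 3"
    using p(2) k by presburger+
  have "\<not> int p dvd a" "\<not> int p dvd b"
    unfolding a_def b_def by (rule coprime_fact, use p(2) k in simp)+
  then have not_dvd: "\<not> int p dvd a ^ 3" "\<not> int p dvd b ^ 6"
    using p(1) prime_dvd_power[of "int p" a 3] prime_dvd_power[of "int p" b 6] by auto
  \<comment> \<open>-3 is the square of 2w + 1, so its power with exponent 3k = (p-1)/2 is 1; this
    determines t^(3k).\<close>
  obtain w where w: "int p dvd w\<^sup>2 + w + 1"
    using cube_root_of_unity_exists[OF p(1)] p_mod by blast
  have "4 * (w\<^sup>2 + w + 1) = (2 * w + 1)\<^sup>2 - (-3)"
    by (simp add: power2_eq_square algebra_simps)
  then have "[(2 * w + 1)\<^sup>2 = -3] (mod int p)"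
    using w by (metis cong_iff_dvd_diff dvd_mult)
  then have "[((2 * w + 1)\<^sup>2) ^ (3 * k) = (-3) ^ (3 * k)] (mod int p)"
    by (rule cong_pow)
  moreover have "[((2 * w + 1)\<^sup>2) ^ (3 * k) = 1] (mod int p)"
    using fermat_int[OF p(1) cube_root_of_unity_discriminant[OF p(1) p_mod(2) w]] p(2)
    by (simp flip: power_mult)
  ultimately have m3: "[(-3) ^ (3 * k) = 1] (mod int p)"
    using cong_sym cong_trans by blast
  have t3: "[t ^ (3 * k) = (-1) ^ k] (mod int p)"
  proof -
    have "[1 * t ^ (3 * k) = (-3) ^ (3 * k) * t ^ (3 * k)] (mod int p)"
      by (rule cong_scalar_right, rule cong_sym, rule m3)
    also have "(-3) ^ (3 * k) * t ^ (3 * k) = (-1 * (3 * t)) ^ (3 * k)"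
      unfolding power_mult_distrib[symmetric] by (rule arg_cong[where f = "\<lambda>x. x ^ (3 * k)"]) simp
    also have "[(-1 * (3 * t)) ^ (3 * k) = (-1 * 1) ^ (3 * k)] (mod int p)"
      by (intro cong_pow cong_scalar_left t)
    finally show ?thesis
      by (simp add: power_mult)
  qed
  have "[4 ^ (3 * k) = 1] (mod int p)"
  proof -
    have "(4::int) ^ (3 * k) = 2 ^ (p - 1)"
      unfolding p(2) by (simp add: power_mult)
    then show ?thesis
      using fermat_int[OF p(1) prime_less[of 2]] p_mod by simp
  qed
  note four = this
  \<comment> \<open>Cubing the duplication formula makes the power of 4 trivial, 4^(3k) = 2^(p-1) =
    1, and brings in (b d)^3 = -1.\<close>
  have bbc: "[b ^ 6 * c ^ 3 = - (a ^ 3)] (mod int p)"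
  proof -
    have "[(b * (b * c)) ^ 3 = (b * (4 ^ k * a * d)) ^ 3] (mod int p)"
      by (intro cong_pow cong_scalar_left bc)
    also have "(b * (4 ^ k * a * d)) ^ 3 = 4 ^ (3 * k) * a ^ 3 * (b * d) ^ 3"
      by (simp add: power_mult_distrib mult_ac flip: power_mult)
    also have "[4 ^ (3 * k) * a ^ 3 * (b * d) ^ 3 = 1 * a ^ 3 * (-1) ^ 3] (mod int p)"
      by (intro cong_mult[of "4 ^ (3 * k) * a ^ 3" "1 * a ^ 3"] cong_pow[of "b * d"] cong_scalar_right four bd)
    finally show ?thesis
      by (simp add: power_mult_distrib flip: power_add power_mult)
  qed
  have Cb: "[C\<^sup>2 * b ^ 6 = 1] (mod int p)"
  proof -
    have "[(b * d)\<^sup>2 = (-1)\<^sup>2] (mod int p)"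
      by (rule cong_pow[OF bd])
    moreover have "(b * d)\<^sup>2 = C\<^sup>2 * b ^ 6"
      unfolding bb[symmetric] by (simp add: power2_eq_square power_numeral_reduce)
    ultimately show ?thesis
      by simp
  qed
  define X where "X = trinomial_coeff k * t ^ (3 * k)"
  have Xa: "[X * a ^ 3 = (-1) ^ k * c] (mod int p)"
  proof -
    have "X * a ^ 3 = t ^ (3 * k) * (trinomial_coeff k * a ^ 3)"
      by (simp add: X_def mult_ac)
    also have "trinomial_coeff k * a ^ 3 = c"
      unfolding a_def c_def by (rule trinomial_coeff_mult_fact)
    finally show ?thesis
      using cong_scalar_right[OF t3] by simp
  qed
  \<comment> \<open>The sign stands for c^2, which supplies the two factors \<open>c\<close> that
    \<open>bbc\<close> needs besides the one from \<open>Xa\<close>.\<close>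
  have "[(-1) ^ Suc k * (a ^ 3 * (X * b ^ 6)) = c * c * (a ^ 3 * (X * b ^ 6))] (mod int p)"
    by (rule cong_scalar_right, rule cong_sym, rule cc)
  also have "c * c * (a ^ 3 * (X * b ^ 6)) = c * c * b ^ 6 * (X * a ^ 3)"
    by (simp add: mult_ac)
  also have "[\<dots> = c * c * b ^ 6 * ((-1) ^ k * c)] (mod int p)"
    by (rule cong_scalar_left[OF Xa])
  also have "c * c * b ^ 6 * ((-1) ^ k * c) = (-1) ^ k * (b ^ 6 * c ^ 3)"
    by (simp add: power3_eq_cube mult_ac)
  also have "[\<dots> = (-1) ^ k * - (a ^ 3)] (mod int p)"
    by (rule cong_scalar_left[OF bbc])
  also have "(-1) ^ k * - (a ^ 3) = (-1) ^ Suc k * (a ^ 3 * 1)"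
    by simp
  finally have "[(-1) ^ Suc k * (a ^ 3 * (X * b ^ 6)) = (-1) ^ Suc k * (a ^ 3 * 1)] (mod int p)" .
  then have "[(-1) ^ Suc k * ((-1) ^ Suc k * (a ^ 3 * (X * b ^ 6))) =
      (-1) ^ Suc k * ((-1) ^ Suc k * (a ^ 3 * 1))] (mod int p)"
    by (rule cong_scalar_left)
  moreover have "(-1) ^ Suc k * ((-1) ^ Suc k * x) = x" for x :: int
    by (simp flip: mult.assoc power_add)
  ultimately have "[a ^ 3 * (X * b ^ 6) = a ^ 3 * 1] (mod int p)"
    by (simp only:)
  then have "[X * b ^ 6 = 1] (mod int p)"
    by (rule cong_mult_cancel_prime[OF p(1) not_dvd(1)])
  then have "[b ^ 6 * X = b ^ 6 * C\<^sup>2] (mod int p)"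
    using cong_trans[OF _ cong_sym[OF Cb]] by (simp add: mult.commute)
  then have "[X = C\<^sup>2] (mod int p)"
    by (rule cong_mult_cancel_prime[OF p(1) not_dvd(2)])
  then show ?thesis
    by (simp add: X_def C_def)
qed

theorem theorem2p1:
  fixes p :: nat
  assumes "prime p" and "p > 3"
  shows
    "rat_cong p (\<Sum>k=0..p-1. of_int (W k) / (-3) ^ k) (\<Sum>k=0..p-1. of_int (W k) / (-9) ^ k)
   \<and> ([p = 1] (mod 3) \<longrightarrow>
        (\<exists>L M :: int. 4 * int p = L\<^sup>2 + 27 * M\<^sup>2 \<and> [L = 1] (mod 3))
      \<and> (\<forall>L M :: int. 4 * int p = L\<^sup>2 + 27 * M\<^sup>2 \<and> [L = 1] (mod 3) \<longrightarrow>
            rat_cong p (\<Sum>k=0..p-1. of_int (W k) / (-3) ^ k) (of_int (- L))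
          \<and> rat_cong p (\<Sum>k=0..p-1. of_int (W k) / (-9) ^ k) (of_int (- L)))
      \<and> (\<forall>L M :: int. 4 * int p = L\<^sup>2 + 27 * M\<^sup>2 \<longrightarrow>
            rat_cong p (\<Sum>k=0..p-1. of_nat ((2 * k) choose k) * (of_int (W k) / (-12) ^ k))
              (of_int (L\<^sup>2))))
   \<and> ([p = 2] (mod 3) \<longrightarrow>
        rat_cong p (\<Sum>k=0..p-1. of_int (W k) / (-3) ^ k) 0
      \<and> rat_cong p (\<Sum>k=0..p-1. of_int (W k) / (-9) ^ k) 0
      \<and> rat_cong p (\<Sum>k=0..p-1. of_nat ((2 * k) choose k) * (of_int (W k) / (-12) ^ k)) 0)"
proof -
  note p = assms
  define S3 S9 S12 :: rat where "S3 = (\<Sum>k=0..p-1. of_int (W k) / (-3) ^ k)"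
    and "S9 = (\<Sum>k=0..p-1. of_int (W k) / (-9) ^ k)"
    and "S12 = (\<Sum>k=0..p-1. of_nat ((2 * k) choose k) * (of_int (W k) / (-12) ^ k))"
  have range: "{0..p - 1} = {..<p}"
    using p by auto
  have p_dvd: "\<not> int p dvd 2" "\<not> int p dvd 3"
    using p zdvd_imp_le[of "int p" 2] zdvd_imp_le[of "int p" 3] by auto
  \<comment> \<open>Inverses of 2 and 3 modulo \<open>p\<close>, from which those of -3, -9, -6 and
    -12 are assembled.\<close>
  then obtain s t :: int where s: "[2 * s = 1] (mod int p)" and t: "[3 * t = 1] (mod int p)"
    using p(1) by (metis cong_solve_coprime_int coprime_commute prime_imp_coprime prime_nat_int_transfer)
  have v: "[-3 * - t = 1] (mod int p)"
    using t by simp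
  have u: "[-9 * - (t * t) = 1] (mod int p)"
    using cong_mult[OF t t] by (simp add: mult_ac)
  have r: "[-6 * - (s * t) = 1] (mod int p)"
    using cong_mult[OF s t] by (simp add: mult_ac)
  have q: "[-12 * - (s * s * t) = 1] (mod int p)"
    using cong_mult[OF cong_mult[OF s s] t] by (simp add: mult_ac)
  have S3: "rat_cong p S3 (of_int (if p mod 3 = 1 then trinomial_coeff (p div 3) else 0))"
  proof -
    \<comment> \<open>The power left over by \<open>sum_W_minus_3_cong\<close> has exponent p - 1,
      hence is 1.\<close>
    have "[trinomial_coeff (p div 3) * (- t) ^ (3 * (p div 3)) = trinomial_coeff (p div 3) * 1] (mod int p)" if "p mod 3 = 1"
    proof (rule cong_scalar_left)
      have "3 * (p div 3) = p - 1"
        using that by presburger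
      moreover have "\<not> int p dvd - t"
        using v p(1) by (metis cong_dvd_iff dvd_mult not_prime_unit prime_nat_int_transfer)
      ultimately show "[(- t) ^ (3 * (p div 3)) = 1] (mod int p)"
        using fermat_int[OF p(1)] by simp
    qed
    then have "[(\<Sum>k<p. W k * (- t) ^ k) = (if p mod 3 = 1 then trinomial_coeff (p div 3) else 0)] (mod int p)"
      using cong_trans[OF sum_W_minus_3_cong[OF p v]] by (cases "p mod 3 = 1") simp_all
    from rat_cong_sum_divide_power[OF p(1) v this] show ?thesis
      by (simp only: S3_def range of_int_minus of_int_numeral)
  qed
  have S9: "rat_cong p S9 (of_int (if p mod 3 = 1 then trinomial_coeff (p div 3) else 0))"
    using rat_cong_sum_divide_power[OF p(1) u cong_trans[OF sum_W_minus_9_cong[OF p u r] sum_trinomial_coeff_cong[OF p r]]]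
    by (simp only: S9_def range of_int_minus of_int_numeral)
  have S12: "rat_cong p S12 (of_int c)"
    if "[(\<Sum>k<p. int ((2 * k) choose k) * W k * (- (s * s * t)) ^ k) = c] (mod int p)" for c
    using rat_cong_sum_divide_power[OF p(1) q that] unfolding S12_def range by simp
  define h where "h = p div 2"
  have h: "p = 2 * h + 1"
    using prime_odd_nat[OF p(1)] p(2) by (simp add: h_def)
  note binomial_sum = sum_binomial_W_minus_12_cong[OF p(1) h q]
  have "rat_cong p S3 S9"
    using rat_cong_trans[OF p(1) S3 rat_cong_sym[OF p(1) S9]] .
  moreover have "(\<exists>L M :: int. 4 * int p = L\<^sup>2 + 27 * M\<^sup>2 \<and> [L = 1] (mod 3))
      \<and> (\<forall>L M :: int. 4 * int p = L\<^sup>2 + 27 * M\<^sup>2 \<and> [L = 1] (mod 3) \<longrightarrow>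
            rat_cong p S3 (of_int (- L)) \<and> rat_cong p S9 (of_int (- L)))
      \<and> (\<forall>L M :: int. 4 * int p = L\<^sup>2 + 27 * M\<^sup>2 \<longrightarrow> rat_cong p S12 (of_int (L\<^sup>2)))"
    if "[p = 1] (mod 3)"
  proof -
    have p_mod: "p mod 3 = 1"
      using that by (simp add: cong_def)
    define n where "n = p div 3"
    have n: "p = 3 * n + 1"
      using p_mod unfolding n_def by presburger
    obtain L0 M0 :: int where LM0: "4 * int p = L0\<^sup>2 + 27 * M0\<^sup>2" "[L0 = 1] (mod 3)"
      and L0: "[int ((2 * n) choose n) = - L0] (mod int p)"
      using cubic_jacobi_sum[OF p(1) n p(2)] by blast
    have sq: "L\<^sup>2 = L0\<^sup>2" if "4 * int p = L\<^sup>2 + 27 * M\<^sup>2" for L M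
      using sq_plus_27_sq_unique[OF p that LM0(1)] .
    have A_L: "[trinomial_coeff n = - L0] (mod int p)"
      by (rule cong_trans[OF trinomial_coeff_third_cong[OF p(1) n p(2)] L0])
    have "rat_cong p S3 (of_int (- L)) \<and> rat_cong p S9 (of_int (- L))"
      if L: "4 * int p = L\<^sup>2 + 27 * M\<^sup>2" "[L = 1] (mod 3)" for L M
    proof -
      have "L = L0 \<or> L = - L0"
        using sq[OF L(1)] by (simp add: power2_eq_iff)
      \<comment> \<open>\<open>L\<close> and \<open>L0\<close> are both 1 modulo 3, which fixes the
        sign.\<close>
      moreover have "L \<noteq> - L0"
        using L(2) LM0(2) unfolding cong_def by presburger
      ultimately have "L = L0"
        by blast
      then show ?thesis
        using S3 S9 rat_cong_trans[OF p(1) _ rat_cong_of_int[OF p(1) A_L]] p_mod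
        by (simp add: n_def)
    qed
    moreover have "rat_cong p S12 (of_int (L\<^sup>2))" if L: "4 * int p = L\<^sup>2 + 27 * M\<^sup>2" for L M
    proof (rule S12)
      \<comment> \<open>As \<open>p\<close> is odd, p = 6k + 1, h = 3k and n = 2k: the C(4k,2k) of
        the third sum is the C(2n,n) of the Jacobi sum, congruent to -L0, and squaring removes the
        sign.\<close>
      define k where "k = p div 6"
      have hk: "h = 3 * k" and n2k: "n = 2 * k"
        using n h unfolding k_def by presburger+
      have k: "p = 6 * k + 1"
        using n n2k by simp
      have T: "[3 * (4 * (s * s * t)) = 1] (mod int p)"
        using q by (simp add: mult_ac)
      have "[(\<Sum>k<p. int ((2 * k) choose k) * W k * (- (s * s * t)) ^ k) =
          trinomial_coeff k * (4 * (s * s * t)) ^ (3 * k)] (mod int p)"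
        using binomial_sum by (simp add: hk)
      also have "[trinomial_coeff k * (4 * (s * s * t)) ^ (3 * k) = (int ((4 * k) choose (2 * k)))\<^sup>2] (mod int p)"
        by (rule trinomial_coeff_sixth_cong[OF p(1) k T])
      also have "[(int ((4 * k) choose (2 * k)))\<^sup>2 = (- L0)\<^sup>2] (mod int p)"
        using cong_pow[OF L0, of 2] by (simp add: n2k)
      also have "(- L0)\<^sup>2 = L\<^sup>2"
        using sq[OF L] by simp
      finally show "[(\<Sum>k<p. int ((2 * k) choose k) * W k * (- (s * s * t)) ^ k) = L\<^sup>2] (mod int p)" .
    qed
    ultimately show ?thesis
      using LM0 by blast
  qed
  moreover have "rat_cong p S3 0 \<and> rat_cong p S9 0 \<and> rat_cong p S12 0" if "[p = 2] (mod 3)"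
  proof -
    have p_mod: "p mod 3 = 2"
      using that by (simp add: cong_def)
    \<comment> \<open>3 dividing h = (p-1)/2 would make p = 1 modulo 3; so no term of the third sum
      survives.\<close>
    then have "\<not> 3 dvd h"
      using h by presburger
    then have "rat_cong p S12 (of_int 0)"
      using binomial_sum by (intro S12) simp
    then show ?thesis
      using S3 S9 p_mod by simp
  qed
  ultimately show ?thesis
    unfolding S3_def S9_def S12_def by blast
qed

end
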